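(* Consider the $T$-round committed-pricing game in the block model with $m$ blocks, block fractions $\alpha_1,\dots,\alpha_m$, $A=\mathrm{diag}(\alpha_1,\dots,\alpha_m)$, network matrix $E\in\mathbb{R}^{m\times m}$, and valuation distribution $F_v$ on $[0,1]$ with density $f_v$ (see context). Suppose that: (i) $E$ is invertible; (ii) the function $x\mapsto x-\frac{1-F_v(x)}{f_v(x)}-\frac{F_v(x)}{\mathbf{1}^T E^{-1}\mathbf{1}}$ is non-decreasing; (iii) $\mathbf{0}\le (EA)^{-1}\mathbf{1}\le (\mathbf{1}^T E^{-1}\mathbf{1})\,\mathbf{1}$ (entry-wise). Then the optimal price sequence in the limit as $n\to\infty$ is $$p_t=(T-t)\,\frac{1-F_v(p_T)}{T\,(\mathbf{1}^T E^{-1}\mathbf{1})}+p_T,\qquad t=1,\dots,T,$$ where $p_T$ is the solution of $$p_T=(1-F_v(p_T))\left(\frac{1}{f_v(p_T)}-\frac{T-1}{T}\,\frac{1}{\mathbf{1}^T E^{-1}\mathbf{1}}\right).$$ In addition, the optimal normalized revenue is $$p_T\,(1-F_v(p_T))+\frac{T-1}{2T}\,\frac{1}{\mathbf{1}^T E^{-1}\mathbf{1}}\,(1-F_v(p_T))^2 .$$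
   Context: Game. A monopolist with unlimited supply and zero marginal cost sells to $n$ buyers over $T$ rounds. Rounds are indexed in decreasing order: round $T$ is the first in time and round $1$ is the last. The seller announces and commits to prices $\mathbf{p}=(p_T,\dots,p_1)$. Each buyer buys at most one unit, at one of the rounds or never. Valuations are i.i.d. from a known continuous distribution $F_v$ on $[0,1]$ and are private. $H^t$ denotes the history of purchases made at rounds $s>t$ (also identified with the set of buyers who bought at those rounds); it is publicly observed. Buyer $i$ with valuation $v^{(i)}$ buying at round $t$ gets utility $v^{(i)}-p_t+\sum_{j\ne i}g_{ij}\mathbf{1}\{j\text{ bought at some round }s>t\}$; a buyer who never buys gets $0$. Buyers are forward-looking and play a perfect Bayesian equilibrium: a buyer who has not yet bought buys at round $t$ if and only if her utility from doing so is at least her maximal expected utility (given $H^t$) from the remaining alternatives. Block model. The buyers are partitioned into $m$ blocks $G_1,\dots,G_m$, with $|G_k|=\alpha_k n$, $\alpha_k\in(0,1]$. $E\in\mathbb{R}^{m\times m}$ has nonnegative entries, and $g_{ij}=E_{kh}/n$ for $i\in G_k$, $j\in G_h$ (including $k=h$). $A=\mathrm{diag}(\alpha_1,\dots,\alpha_m)$, and $\mathbf{1}$ is the all-ones vector. Buyers' equilibrium. Buyers play the symmetric equilibrium, in which the strategy of a buyer depends only on her block, her valuation, the history and the prices. For a price sequence that is non-decreasing over time ($p_T\le\dots\le p_1$) it is described by block thresholds $v_t^{(h)}$ (depending on $H^t$): a remaining buyer in block $G_h$ buys at round $t$ if and only if her valuation is at least $v_t^{(h)}$, where $v^{(h)}_{T+1}=1$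 and, for $t=T,\dots,2$, $$\sum_{k=1}^m |G_k\setminus H^t|\,\tfrac{E_{hk}}{n}\,\mathbb{P}[v\ge v_t^{(k)}\mid v\le v_{t+1}^{(k)}]=p_{t-1}-p_t,\quad h=1,\dots,m,$$ and at the last round $t=1$ a remaining buyer buys if and only if her utility from buying is non-negative. Revenue. The expected revenue for $\mathbf{p}$ is $\sum_{t=1}^T\sum_{i=1}^n p_t\,\mathbb{P}[i\text{ buys at round }t]$. The normalized revenue is the expected revenue divided by $n$. The optimal price sequence in the limit is the one maximizing the limit, as $n\to\infty$, of the normalized revenue under the buyers' equilibrium (price sequences may be taken non-decreasing over time); the optimal normalized revenue is the corresponding maximal value.
   Formalization: Assumes p_T in [0,1] solves the equation with f_v(p_T)>0 (uniform F_v, 1^T E^{-1} 1=1/2, T=3 has no solution) and f_v>0 on (0,1); where the threshold equations have no solution giving the threshold type non-negative utility, buyers with non-negative utility buy. *)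

theory Defs
  imports "HOL-Probability.Probability"
begin

text \<open>
  Buyers are the numbers below \<open>n\<close>, blocks are the elements of a finite type \<open>'m\<close>, and \<open>b i\<close> is
  the block of buyer \<open>i\<close>. Rounds are counted down: \<open>T\<close> is the first and \<open>1\<close> the last one.
  A history at round \<open>t\<close> is the list of the sets of buyers who bought at rounds \<open>t + 1, \<dots>, T\<close>,
  most recent round first, so that the current round is \<open>T - length H\<close>.
  A symmetric threshold strategy \<open>thr\<close> maps a history and a block to a threshold valuation.
\<close>

definition valuation :: "(real \<Rightarrow> real) \<Rightarrow> real measure" where
  "valuation f = density lborel (\<lambda>x. ennreal (f x))"

definition valuations :: "(real \<Rightarrow> real) \<Rightarrow> nat \<Rightarrow> (nat \<Rightarrow> real) measure" where
  "valuations f n = PiM {..<n} (\<lambda>_. valuation f)"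

definition bought :: "nat set list \<Rightarrow> nat set" where
  "bought H = \<Union> (set H)"

text \<open>
  Utility of a buyer of block \<open>h\<close> with valuation \<open>x\<close> who has not bought before and buys at
  round \<open>t\<close>. Such a buyer is not in \<open>bought H\<close>, so no term has to be removed from the sum.
\<close>

definition utility ::
  "real^'m^'m \<Rightarrow> nat \<Rightarrow> (nat \<Rightarrow> 'm) \<Rightarrow> (nat \<Rightarrow> real) \<Rightarrow> nat \<Rightarrow> nat set list \<Rightarrow> 'm::finite \<Rightarrow> real \<Rightarrow> real"
  where
  "utility E n b p t H h x = x - p t + (\<Sum>j\<in>bought H. E $ h $ b j / real n)"

text \<open>
  Upper bound on the valuations of those buyers of block \<open>h\<close> who have not bought yet. As long as the
  thresholds decrease over time this is the threshold of the previous round (and 1 at round \<open>T\<close>).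
\<close>

fun upper :: "(nat set list \<Rightarrow> 'm \<Rightarrow> real) \<Rightarrow> nat set list \<Rightarrow> 'm \<Rightarrow> real" where
  "upper thr [] h = 1"
| "upper thr (D # H) h = min (upper thr H h) (thr H h)"

text \<open>
  The threshold equations at round \<open>t\<close>: buyers are indifferent between buying at round \<open>t\<close> and at
  round \<open>t - 1\<close>. Never buying, with utility 0, is also an alternative, so the thresholds can
  describe an equilibrium only if buying at the threshold has non-negative utility.
\<close>

definition indifferent ::
  "(real \<Rightarrow> real) \<Rightarrow> real^'m^'m \<Rightarrow> nat \<Rightarrow> (nat \<Rightarrow> 'm) \<Rightarrow> (nat \<Rightarrow> real) \<Rightarrow> nat \<Rightarrow> nat set list \<Rightarrow>
    ('m::finite \<Rightarrow> real) \<Rightarrow> ('m \<Rightarrow> real) \<Rightarrow> bool"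
  where
  "indifferent f E n b p t H u \<theta> \<longleftrightarrow>
    (\<forall>h. \<theta> h \<le> u h \<and> 0 \<le> utility E n b p t H h (\<theta> h) \<and>
      (\<Sum>k\<in>UNIV. real (card ({i. i < n \<and> b i = k} - bought H)) * (E $ h $ k / real n) *
          \<P>(x in valuation f. \<theta> k \<le> x \<bar> x \<le> u k)) = p (t - 1) - p t)"

text \<open>
  For every finite \<open>n\<close> there are histories at which the threshold equations have no solution of this
  kind: too few buyers able to buy with non-negative utility are left for the network gain of waiting
  to make up for the price increase, so that waiting does not pay. At these histories, as at the last
  round, precisely the remaining buyers with non-negative utility from buying buy.
\<close>

definition equilibrium ::
  "(real \<Rightarrow> real) \<Rightarrow> real^'m^'m \<Rightarrow> nat \<Rightarrow> (nat \<Rightarrow> 'm) \<Rightarrow> nat \<Rightarrow> (nat \<Rightarrow> real) \<Rightarrow>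
    (nat set list \<Rightarrow> 'm::finite \<Rightarrow> real) \<Rightarrow> bool"
  where
  "equilibrium f E n b T p thr \<longleftrightarrow>
    (\<forall>H t. \<Union> (set H) \<subseteq> {..<n} \<longrightarrow> 1 \<le> t \<longrightarrow> t + length H = T \<longrightarrow>
      (if 2 \<le> t \<and> (\<exists>\<theta>. indifferent f E n b p t H (upper thr H) \<theta>)
       then indifferent f E n b p t H (upper thr H) (thr H)
       else (\<forall>h. utility E n b p t H h (thr H h) = 0)))"

definition buyers ::
  "nat \<Rightarrow> (nat \<Rightarrow> 'm) \<Rightarrow> (nat set list \<Rightarrow> 'm \<Rightarrow> real) \<Rightarrow> (nat \<Rightarrow> real) \<Rightarrow> nat set list \<Rightarrow> nat set"
  where
  "buyers n b thr v H = {i. i < n \<and> i \<notin> bought H \<and> thr H (b i) \<le> v i}"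

text \<open>The realized history after \<open>k\<close> rounds when the valuations are \<open>v\<close>.\<close>

fun history ::
  "nat \<Rightarrow> (nat \<Rightarrow> 'm) \<Rightarrow> (nat set list \<Rightarrow> 'm \<Rightarrow> real) \<Rightarrow> (nat \<Rightarrow> real) \<Rightarrow> nat \<Rightarrow> nat set list"
  where
  "history n b thr v 0 = []"
| "history n b thr v (Suc k) = buyers n b thr v (history n b thr v k) # history n b thr v k"

definition revenue ::
  "(real \<Rightarrow> real) \<Rightarrow> nat \<Rightarrow> (nat \<Rightarrow> 'm) \<Rightarrow> nat \<Rightarrow> (nat \<Rightarrow> real) \<Rightarrow>
    (nat set list \<Rightarrow> 'm \<Rightarrow> real) \<Rightarrow> real"
  where
  "revenue f n b T p thr =
    (\<Sum>t=1..T. \<Sum>i<n. p t * \<P>(v in valuations f n. i \<in> buyers n b thr v (history n b thr v (T - t))))"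

text \<open>
  The limit is taken along block models with \<open>N j\<close> buyers and block assignment \<open>b j\<close>.
\<close>

definition limit_revenue ::
  "(real \<Rightarrow> real) \<Rightarrow> real^'m^'m \<Rightarrow> (nat \<Rightarrow> nat) \<Rightarrow> (nat \<Rightarrow> nat \<Rightarrow> 'm::finite) \<Rightarrow> nat \<Rightarrow>
    (nat \<Rightarrow> real) \<Rightarrow> real \<Rightarrow> bool"
  where
  "limit_revenue f E N b T p L \<longleftrightarrow>
    (\<forall>j. \<exists>thr. equilibrium f E (N j) (b j) T p thr) \<and>
    (\<forall>thr. (\<forall>j. equilibrium f E (N j) (b j) T p (thr j)) \<longrightarrow>
      (\<lambda>j. revenue f (N j) (b j) T p (thr j) / real (N j)) \<longlonglongrightarrow> L)"

definition nondecreasing_prices :: "nat \<Rightarrow> (nat \<Rightarrow> real) \<Rightarrow> bool" where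
  "nondecreasing_prices T p \<longleftrightarrow> (\<forall>t. 1 \<le> t \<and> t < T \<longrightarrow> p (t + 1) \<le> p t)"

text \<open>\<open>p\<close> is the unique optimal price sequence in the limit, with optimal value \<open>R\<close>.\<close>

definition optimal_prices ::
  "(real \<Rightarrow> real) \<Rightarrow> real^'m^'m \<Rightarrow> (nat \<Rightarrow> nat) \<Rightarrow> (nat \<Rightarrow> nat \<Rightarrow> 'm::finite) \<Rightarrow> nat \<Rightarrow>
    (nat \<Rightarrow> real) \<Rightarrow> real \<Rightarrow> bool"
  where
  "optimal_prices f E N b T p R \<longleftrightarrow>
    nondecreasing_prices T p \<and> limit_revenue f E N b T p R \<and>
    (\<forall>q. nondecreasing_prices T q \<longrightarrow>
      (\<exists>L. limit_revenue f E N b T q L \<and> L \<le> R \<and> (L = R \<longrightarrow> (\<forall>t\<in>{1..T}. q t = p t))))"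

definition diag :: "real^'m \<Rightarrow> real^'m^'m" where
  "diag a = (\<chi> i j. if i = j then a $ i else 0)"

abbreviation ones :: "real^'m" where
  "ones \<equiv> (\<chi> i. 1)"

end

theory Submission
  imports Defs "HOL-Real_Asymp.Real_Asymp"
begin

text \<open>
  Condition (iii) forces \<open>E \<alpha> = (1/s) 1\<close>: every block exerts and feels the same total influence, and
  in the limit all blocks behave alike. Write \<open>Q = 1 - F (p T)\<close>. By the threshold equations, a
  fraction \<open>m\<^sub>t = min (s (p t - p T)) Q\<close> of the buyers has bought before round \<open>t\<close>, whose influence
  \<open>m\<^sub>t / s\<close> lowers the price \<open>p t\<close> to the effective price \<open>p T\<close> as long as \<open>m\<^sub>t < Q\<close>. This is a
  deterministic consequence of the empirical distributions of the valuations in all blocks being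
  uniformly close to \<open>F\<close>, which has high probability by Hoeffding's inequality on a finite grid.

  The limit revenue is then
  \<open>p T * Q + (1/s) \<Sum>\<^sub>t m\<^sub>t (m\<^sub>t\<^sub>-\<^sub>1 - m\<^sub>t)\<close>. For fixed \<open>p T\<close> the sum is largest precisely when the
  increments are all equal to \<open>Q / T\<close>, which leaves the maximization of
  \<open>x (1 - F x) + (T - 1) / (2 T s) (1 - F x)\<^sup>2\<close> over \<open>x = p T\<close>. Its formal derivative is \<open>- f \<psi>\<close>,
  where \<open>\<psi>\<close> is strictly increasing by condition (ii) and vanishes at \<open>pT\<close>.
\<close>

section \<open>Valuations with a density on the unit interval\<close>

locale unit_density =
  fixes f :: "real \<Rightarrow> real"
  assumes measurable_f [measurable]: "f \<in> borel_measurable borel"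
    and nonneg: "0 \<le> f x"
    and outside: "x \<notin> {0..1} \<Longrightarrow> f x = 0"
    and prob: "prob_space (valuation f)"
    and pos: "x \<in> {0<..<1} \<Longrightarrow> 0 < f x"

sublocale unit_density \<subseteq> V: real_distribution "valuation f"
proof -
  interpret prob_space "valuation f" by (rule prob)
  show "real_distribution (valuation f)"
    by unfold_locales (simp add: valuation_def)
qed

context unit_density
begin

abbreviation F :: "real \<Rightarrow> real" where
  "F \<equiv> cdf (valuation f)"

lemma null_set_singleton: "{x} \<in> null_sets (valuation f)"
proof -
  have "AE y in lborel. y \<in> {x} \<longrightarrow> ennreal (f y) = 0"
    using AE_lborel_singleton[of x] by eventually_elim auto
  then show ?thesis
    unfolding valuation_def by (subst null_sets_density_iff) auto
qed

lemma measure_singleton: "measure (valuation f) {x} = 0"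
  using null_set_singleton by (simp add: null_sets_def measure_def)

lemma isCont_F: "isCont F x"
  by (simp add: V.isCont_cdf measure_singleton)

lemma continuous_on_F: "continuous_on A F"
  by (simp add: continuous_at_imp_continuous_on isCont_F)

lemma F_mono: "x \<le> y \<Longrightarrow> F x \<le> F y"
  by (rule V.cdf_nondecreasing)

lemma F_ge_0: "0 \<le> F x" and F_le_1: "F x \<le> 1"
  by (auto simp: V.cdf_nonneg V.cdf_bounded_prob)

lemma AE_valuation: "AE x in valuation f. 0 < x \<and> x < 1"
proof -
  have "AE x in lborel. x \<noteq> 0 \<and> x \<noteq> (1::real)"
    using AE_lborel_singleton[of "0::real"] AE_lborel_singleton[of "1::real"] by eventually_elim auto
  then have "AE x in lborel. 0 < ennreal (f x) \<longrightarrow> 0 < x \<and> x < 1"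
  proof eventually_elim
    case (elim x)
    then show ?case using outside[of x] by (cases "x \<in> {0..1}") auto
  qed
  then show ?thesis
    unfolding valuation_def by (subst AE_density) auto
qed

lemma F_eq_0: "x \<le> 0 \<Longrightarrow> F x = 0"
  unfolding cdf_def by (subst V.prob_eq_0) (use AE_valuation in \<open>auto elim!: eventually_mono\<close>)

lemma F_eq_1:
  assumes "1 \<le> x"
  shows "F x = 1"
proof -
  have "AE y in valuation f. y \<in> {..x}"
    using AE_valuation by eventually_elim (use assms in auto)
  then show ?thesis
    unfolding cdf_def by (subst V.prob_eq_1) auto
qed

lemma measure_atLeastAtMost: "x \<le> y \<Longrightarrow> measure (valuation f) {x..y} = F y - F x"
proof (cases "x = y")
  case True
  then show ?thesis by (simp add: measure_singleton)
next
  case False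
  assume "x \<le> y"
  then have "{x..y} = {x} \<union> {x<..y}" by auto
  then have "measure (valuation f) {x..y} = measure (valuation f) {x<..y}"
    using measure_Un_null_set[of "{x<..y}" "valuation f" "{x}"] null_set_singleton
    by (simp add: sup_commute)
  then show ?thesis using V.cdf_diff_eq[of x y] False \<open>x \<le> y\<close> by simp
qed

lemma measure_lessThan: "measure (valuation f) {..<x} = F x"
proof -
  have "{..x} = {..<x} \<union> {x}" by auto
  then show ?thesis
    unfolding cdf_def using measure_Un_null_set[of "{..<x}" "valuation f" "{x}"] null_set_singleton by simp
qed

text \<open>The conditional probability of the threshold equations. The case \<open>F u = 0\<close>
  is included, as division by zero gives 0 on both sides.\<close>

lemma cond_prob_ge:
  assumes "\<theta> \<le> u"
  shows "\<P>(x in valuation f. \<theta> \<le> x \<bar> x \<le> u) = (F u - F \<theta>) / F u"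
  using measure_atLeastAtMost[OF assms]
  by (simp add: cond_prob_def cdf_def atLeastAtMost_def atLeast_def atMost_def Collect_conj_eq)

lemma integrable_f: "integrable lborel f"
proof -
  have "(\<integral>\<^sup>+x. ennreal (f x) \<partial>lborel) = 1"
    using V.emeasure_space_1 by (simp add: valuation_def emeasure_density)
  then show ?thesis
    by (intro integrableI_nonneg) (auto simp: nonneg)
qed

lemma integral_f_Icc:
  assumes "x \<le> y"
  shows "(\<integral>w. indicator {x..y} w * f w \<partial>lborel) = F y - F x"
proof -
  have "measure (valuation f) {x..y} = enn2real (\<integral>\<^sup>+w. ennreal (indicator {x..y} w * f w) \<partial>lborel)"
    unfolding valuation_def measure_def
    by (subst emeasure_density) (auto intro!: arg_cong[where f=enn2real] nn_integral_cong split: split_indicator)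
  also have "\<dots> = (\<integral>w. indicator {x..y} w * f w \<partial>lborel)"
    by (rule integral_eq_nn_integral[symmetric]) (auto simp: nonneg)
  finally show ?thesis using measure_atLeastAtMost[OF assms] by simp
qed

text \<open>If \<open>F\<close> were constant on \<open>{x..y}\<close>, the density would integrate
  to 0 and hence vanish almost everywhere there, against its positivity on an interval of positive
  length.\<close>

lemma F_strict_mono:
  assumes "0 \<le> x" "x < y" "y \<le> 1"
  shows "F x < F y"
proof (rule ccontr)
  assume "\<not> F x < F y"
  with F_mono[of x y] assms have "F y - F x = 0" by simp
  then have "(\<integral>w. indicator {x..y} w * f w \<partial>lborel) = 0"
    using integral_f_Icc[of x y] assms by simp
  moreover have "integrable lborel (\<lambda>w. indicator {x..y} w * f w)"
    using integrable_mult_indicator[OF _ integrable_f, of "{x..y}"] by simp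
  ultimately have "AE w in lborel. indicator {x..y} w * f w = 0"
    by (subst (asm) integral_nonneg_eq_0_iff_AE) (auto simp: nonneg)
  then have "AE w in lborel. w \<notin> {x<..<y}"
  proof eventually_elim
    case (elim w)
    then show ?case using pos[of w] assms by (auto split: split_indicator_asm)
  qed
  then have "emeasure lborel {x<..<y} = 0"
    by (subst (asm) AE_iff_null) (auto simp: null_sets_def simp del: greaterThanLessThan_iff)
  then show False using assms by simp
qed

end

section \<open>Equilibrium thresholds\<close>

text \<open>Thresholds at a history depend on the upper bounds there, and these on the thresholds at
  shorter histories. The rule \<open>c\<close> receives both the history and the bounds, so that a
  strategy is generated by recursion along the history.\<close>

primrec upper_of :: "(nat set list \<Rightarrow> ('m \<Rightarrow> real) \<Rightarrow> 'm \<Rightarrow> real) \<Rightarrow> nat set list \<Rightarrow> 'm \<Rightarrow> real" where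
  "upper_of c [] = (\<lambda>h. 1)"
| "upper_of c (D # H) = (\<lambda>h. min (upper_of c H h) (c H (upper_of c H) h))"

lemma upper_upper_of: "upper (\<lambda>H. c H (upper_of c H)) H = upper_of c H"
  by (induction H) auto

text \<open>The condition at a history involves the thresholds of earlier rounds only through the
  upper bounds. So thresholds are chosen history by history: a solution of the threshold equations
  if there is one, and otherwise the valuation with zero utility.\<close>

lemma equilibrium_exists: "\<exists>thr. equilibrium f E n b T p thr"
proof -
  define c where "c H u = (if 2 \<le> T - length H \<and> (\<exists>\<theta>. indifferent f E n b p (T - length H) H u \<theta>)
      then SOME \<theta>. indifferent f E n b p (T - length H) H u \<theta>
      else (\<lambda>h. p (T - length H) - (\<Sum>j\<in>bought H. E $ h $ b j / real n)))" for H u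
  have "equilibrium f E n b T p (\<lambda>H. c H (upper_of c H))"
    unfolding equilibrium_def upper_upper_of
  proof (intro allI impI)
    fix H :: "nat set list" and t :: nat
    assume "t + length H = T"
    then have t: "T - length H = t" by simp
    show "if 2 \<le> t \<and> (\<exists>\<theta>. indifferent f E n b p t H (upper_of c H) \<theta>)
       then indifferent f E n b p t H (upper_of c H) (c H (upper_of c H))
       else (\<forall>h. utility E n b p t H h (c H (upper_of c H) h) = 0)"
      using someI_ex[of "indifferent f E n b p t H (upper_of c H)"]
      by (auto simp: c_def t utility_def)
  qed
  then show ?thesis by blast
qed

text \<open>Measured as a fraction of all \<open>n\<close> buyers, not of block \<open>k\<close>, so
  that it enters the network sums with the plain weight \<open>E $ h $ k\<close>.\<close>

definition unsold :: "nat \<Rightarrow> (nat \<Rightarrow> 'm) \<Rightarrow> nat set list \<Rightarrow> 'm \<Rightarrow> real" where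
  "unsold n b H k = real (card ({i. i < n \<and> b i = k} - bought H)) / real n"

lemma bought_Cons: "bought (D # H) = D \<union> bought H"
  by (simp add: bought_def)

lemma bought_history: "bought (history n b thr v r) \<subseteq> {..<n}"
  by (induction r) (auto simp: bought_def buyers_def)

lemma length_history [simp]: "length (history n b thr v r) = r"
  by (induction r) auto

text \<open>\<open>upper\<close> is the running minimum of 1 and the thresholds met so far, and a
  buyer is left over iff her valuation lies below all of them. The initial value 1 is the reason for
  \<open>v i < 1\<close>.\<close>

lemma not_bought_history_iff:
  assumes "i < n" "v i < 1"
  shows "i \<notin> bought (history n b thr v r) \<longleftrightarrow> v i < upper thr (history n b thr v r) (b i)"
  using assms by (induction r) (auto simp: bought_def buyers_def)

text \<open>Turns the random set of remaining buyers into an empirical count below a level, so that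
  only the empirical distributions within the blocks matter.\<close>

lemma unsold_history:
  assumes "\<And>i. i < n \<Longrightarrow> v i < 1"
  shows "unsold n b (history n b thr v r) k =
    real (card {i. i < n \<and> b i = k \<and> v i < upper thr (history n b thr v r) k}) / real n"
proof -
  have "{i. i < n \<and> b i = k} - bought (history n b thr v r) =
      {i. i < n \<and> b i = k \<and> v i < upper thr (history n b thr v r) k}"
    using not_bought_history_iff[of _ n v b thr r] assms by auto
  then show ?thesis by (simp add: unsold_def)
qed

lemma sum_blocks:
  fixes b :: "nat \<Rightarrow> 'm::finite" and g :: "'m \<Rightarrow> real"
  assumes "finite B"
  shows "(\<Sum>j\<in>B. g (b j)) = (\<Sum>k\<in>UNIV. g k * real (card {j\<in>B. b j = k}))"
proof -
  have "(\<Sum>j\<in>B. g (b j)) = (\<Sum>k\<in>UNIV. \<Sum>j\<in>{j\<in>B. b j = k}. g (b j))"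
    using assms by (subst sum.group) auto
  also have "\<dots> = (\<Sum>k\<in>UNIV. g k * real (card {j\<in>B. b j = k}))"
    by (intro sum.cong) auto
  finally show ?thesis .
qed

lemma nondecreasing_pricesD:
  assumes "nondecreasing_prices T p" "1 \<le> i" "i \<le> j" "j \<le> T"
  shows "p j \<le> p i"
  using assms(3,4)
proof (induction j rule: dec_induct)
  case (step j)
  then have "p (j + 1) \<le> p j"
    using assms(1,2) by (auto simp: nondecreasing_prices_def)
  with step show ?case by simp
qed simp

section \<open>Threshold equations in a network with balanced influence\<close>

locale balanced_network = unit_density f for f :: "real \<Rightarrow> real" +
  fixes E :: "real^'m^'m" and \<alpha> :: "real^'m" and s :: real
  assumes invertible: "invertible E"
    and balanced: "(\<Sum>k\<in>UNIV. E $ h $ k * \<alpha> $ k) = 1 / s"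
    and s_pos: "0 < s"
    and \<alpha>_pos: "0 < \<alpha> $ k"
    and \<alpha>_sum: "(\<Sum>k\<in>UNIV. \<alpha> $ k) = 1"
begin

text \<open>Balance makes \<open>s * \<Delta> * \<alpha> $ k\<close> a solution of the linear system
  with all right-hand sides \<open>\<Delta>\<close>, and invertibility makes it the only
  one.\<close>

lemma E_sum_cancel:
  assumes "\<And>h. (\<Sum>k\<in>UNIV. E $ h $ k * y k) = \<Delta>"
  shows "y k = s * \<Delta> * \<alpha> $ k"
proof -
  have "E *v (\<chi> k. y k) = E *v (\<chi> k. s * \<Delta> * \<alpha> $ k)"
    using assms balanced s_pos
    by (simp add: matrix_vector_mult_def vec_eq_iff mult.left_commute flip: sum_distrib_left)
  then have "(\<chi> k. y k) = (\<chi> k. s * \<Delta> * \<alpha> $ k)"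
    using invertible by (metis inj_eq inj_matrix_vector_mult)
  then show ?thesis by (simp add: vec_eq_iff)
qed

definition blocks_ok :: "nat \<Rightarrow> (nat \<Rightarrow> 'm) \<Rightarrow> bool" where
  "blocks_ok n b \<longleftrightarrow> 0 < n \<and> (\<forall>k. real (card {i. i < n \<and> b i = k}) = \<alpha> $ k * real n)"

text \<open>The valuation at which buying now has utility 0. Under \<open>blocks_ok\<close>,
  \<open>\<alpha> $ k - unsold n b H k\<close> is the fraction of all buyers who are in block
  \<open>k\<close> and have bought already.\<close>

definition cutoff :: "nat \<Rightarrow> (nat \<Rightarrow> 'm) \<Rightarrow> (nat \<Rightarrow> real) \<Rightarrow> nat \<Rightarrow> nat set list \<Rightarrow> 'm \<Rightarrow> real" where
  "cutoff n b p t H h = p t - (\<Sum>k\<in>UNIV. E $ h $ k * (\<alpha> $ k - unsold n b H k))"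

lemma utility_eq_cutoff:
  assumes "blocks_ok n b" "bought H \<subseteq> {..<n}"
  shows "utility E n b p t H h x = x - cutoff n b p t H h"
proof -
  have fin: "finite (bought H)" using assms(2) finite_subset by auto
  have "(\<Sum>j\<in>bought H. E $ h $ b j / real n) =
      (\<Sum>k\<in>UNIV. E $ h $ k / real n * real (card {j\<in>bought H. b j = k}))"
    by (rule sum_blocks[OF fin])
  also have "\<dots> = (\<Sum>k\<in>UNIV. E $ h $ k * (\<alpha> $ k - unsold n b H k))"
  proof (intro sum.cong refl)
    fix k
    have "card {j\<in>bought H. b j = k} + card ({i. i < n \<and> b i = k} - bought H) = card {i. i < n \<and> b i = k}"
      using assms(2) by (subst card_Un_disjoint[symmetric]) (auto simp: fin intro!: arg_cong[where f=card])
    then have "real (card {j\<in>bought H. b j = k}) = \<alpha> $ k * real n - unsold n b H k * real n"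
      using assms(1) by (simp add: unsold_def blocks_ok_def algebra_simps flip: of_nat_add)
    then show "E $ h $ k / real n * real (card {j\<in>bought H. b j = k}) = E $ h $ k * (\<alpha> $ k - unsold n b H k)"
      using assms(1) unfolding blocks_ok_def by (simp add: diff_divide_distrib right_diff_distrib)
  qed
  finally show ?thesis by (simp add: utility_def cutoff_def)
qed

text \<open>The coupled equations are linear in the expected sales of the blocks, so
  \<open>E_sum_cancel\<close> solves them: each block gets its own scalar equation, with expected
  sales proportional to its size.\<close>

lemma indifferent_iff:
  assumes "blocks_ok n b" "bought H \<subseteq> {..<n}"
  shows "indifferent f E n b p t H u \<theta> \<longleftrightarrow>
    (\<forall>h. \<theta> h \<le> u h \<and> cutoff n b p t H h \<le> \<theta> h \<and>
      unsold n b H h * ((F (u h) - F (\<theta> h)) / F (u h)) = s * (p (t - 1) - p t) * \<alpha> $ h)"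
    (is "?L \<longleftrightarrow> ?R")
proof
  assume L: ?L
  then have le: "\<theta> h \<le> u h" "cutoff n b p t H h \<le> \<theta> h" for h
    by (auto simp: indifferent_def utility_eq_cutoff[OF assms])
  have "(\<Sum>k\<in>UNIV. E $ h $ k * (unsold n b H k * ((F (u k) - F (\<theta> k)) / F (u k)))) = p (t - 1) - p t" for h
    using L by (auto simp: indifferent_def cond_prob_ge le unsold_def mult_ac)
  from E_sum_cancel[OF this] le show ?R by blast
next
  assume R: ?R
  then have le: "\<theta> h \<le> u h" for h by blast
  have "(\<Sum>k\<in>UNIV. real (card ({i. i < n \<and> b i = k} - bought H)) * (E $ h $ k / real n) *
          \<P>(x in valuation f. \<theta> k \<le> x \<bar> x \<le> u k)) = p (t - 1) - p t" for h
  proof -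
    have "(\<Sum>k\<in>UNIV. real (card ({i. i < n \<and> b i = k} - bought H)) * (E $ h $ k / real n) *
          \<P>(x in valuation f. \<theta> k \<le> x \<bar> x \<le> u k)) =
        (\<Sum>k\<in>UNIV. E $ h $ k * (unsold n b H k * ((F (u k) - F (\<theta> k)) / F (u k))))"
      by (intro sum.cong) (auto simp: cond_prob_ge le unsold_def)
    also have "\<dots> = (\<Sum>k\<in>UNIV. s * (p (t - 1) - p t) * (E $ h $ k * \<alpha> $ k))"
    proof (intro sum.cong refl)
      fix k
      have "unsold n b H k * ((F (u k) - F (\<theta> k)) / F (u k)) = s * (p (t - 1) - p t) * \<alpha> $ k"
        using R by blast
      then show "E $ h $ k * (unsold n b H k * ((F (u k) - F (\<theta> k)) / F (u k))) =
          s * (p (t - 1) - p t) * (E $ h $ k * \<alpha> $ k)"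
        by (simp only: mult_ac)
    qed
    also have "\<dots> = p (t - 1) - p t"
      using balanced s_pos by (simp flip: sum_distrib_left)
    finally show ?thesis .
  qed
  with R show ?L by (auto simp: indifferent_def utility_eq_cutoff[OF assms])
qed

section \<open>One round of play at a fixed history\<close>

context
  fixes n b T p thr t and H :: "nat set list"
  assumes ok: "blocks_ok n b" and H: "bought H \<subseteq> {..<n}"
    and eq: "equilibrium f E n b T p thr" and t: "1 \<le> t" "t + length H = T"
begin

lemma equilibrium_cases:
  obtains (indifferent) "2 \<le> t" "indifferent f E n b p t H (upper thr H) (thr H)"
  | (cutoff) "\<not> (2 \<le> t \<and> (\<exists>\<theta>. indifferent f E n b p t H (upper thr H) \<theta>))" "\<And>h. thr H h = cutoff n b p t H h"
proof (cases "2 \<le> t \<and> (\<exists>\<theta>. indifferent f E n b p t H (upper thr H) \<theta>)")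
  case True
  then have "indifferent f E n b p t H (upper thr H) (thr H)"
    using eq H t unfolding equilibrium_def bought_def[symmetric] by (auto dest!: spec[of _ H] spec[of _ t])
  then show ?thesis using True indifferent by blast
next
  case False
  then have "\<forall>h. utility E n b p t H h (thr H h) = 0"
    using eq H t unfolding equilibrium_def bought_def[symmetric] by (auto dest!: spec[of _ H] spec[of _ t])
  then show ?thesis using False cutoff by (simp add: utility_eq_cutoff[OF ok H])
qed

lemma F_upper_Cons_le: "F (upper thr (D # H) k) \<le> F (upper thr H k)"
  by (simp add: F_mono)

text \<open>In either case the threshold is at least the cutoff: a solution of the threshold
  equations has non-negative utility at the threshold, and otherwise the threshold is the cutoff
  itself.\<close>

lemma F_upper_Cons_ge: "min (F (upper thr H k)) (F (cutoff n b p t H k)) \<le> F (upper thr (D # H) k)"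
proof -
  have "cutoff n b p t H k \<le> thr H k"
    by (cases rule: equilibrium_cases) (auto simp: indifferent_iff[OF ok H])
  then show ?thesis
    using F_mono[of "cutoff n b p t H k" "thr H k"] by (auto simp: min_def)
qed

text \<open>If the unsold fraction were exactly \<open>\<alpha> $ k * F (upper thr H k)\<close>, the
  scalar equation would lower \<open>F\<close> at the bound by exactly
  \<open>s * (p (t - 1) - p t)\<close>. The deviation enters multiplied by a purchase probability of
  at most 1 and divided by \<open>\<alpha> $ k\<close>.\<close>

lemma F_upper_Cons_indifferent:
  assumes "indifferent f E n b p t H (upper thr H) (thr H)"
    and e: "\<bar>unsold n b H k - \<alpha> $ k * F (upper thr H k)\<bar> \<le> e"
  shows "\<bar>F (upper thr (D # H) k) - (F (upper thr H k) - s * (p (t - 1) - p t))\<bar> \<le> e / \<alpha> $ k"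
proof -
  let ?w = "F (upper thr H k)" and ?x = "F (thr H k)"
  have le: "thr H k \<le> upper thr H k"
    and q: "unsold n b H k * ((?w - ?x) / ?w) = s * (p (t - 1) - p t) * \<alpha> $ k"
    using assms(1) by (auto simp: indifferent_iff[OF ok H])
  have q01: "\<bar>(?w - ?x) / ?w\<bar> \<le> 1"
    using F_mono[OF le] F_ge_0[of "thr H k"] F_ge_0[of "upper thr H k"] by (auto simp: divide_simps)
  \<comment> \<open>Also true for \<open>?w = 0\<close>: then \<open>?x\<close>, which lies between
    0 and \<open>?w\<close>, is 0 too.\<close>
  have wq: "?w * ((?w - ?x) / ?w) = ?w - ?x"
    using F_mono[OF le] F_ge_0[of "thr H k"] by auto
  have "\<alpha> $ k * (?x - (?w - s * (p (t - 1) - p t))) = 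
      (unsold n b H k - \<alpha> $ k * ?w) * ((?w - ?x) / ?w)"
    unfolding left_diff_distrib q mult.assoc wq by (simp add: algebra_simps)
  also have "\<bar>\<dots>\<bar> \<le> e * 1"
    unfolding abs_mult using e q01 by (intro mult_mono) auto
  finally have "\<alpha> $ k * \<bar>?x - (?w - s * (p (t - 1) - p t))\<bar> \<le> e"
    using \<alpha>_pos[of k] by (simp add: abs_mult)
  moreover have "upper thr (D # H) k = thr H k"
    using le by simp
  ultimately show ?thesis
    using \<alpha>_pos[of k] by (simp add: field_simps)
qed

text \<open>Meant for rounds at which it is open whether the threshold equations are solvable: the
  first argument of the maximum covers indifference, the second the use of the cutoff.\<close>

lemma F_upper_Cons_le_max:
  assumes e: "\<bar>unsold n b H k - \<alpha> $ k * F (upper thr H k)\<bar> \<le> e"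
  shows "F (upper thr (D # H) k) \<le>
    max (F (upper thr H k) - s * (p (t - 1) - p t) + e / \<alpha> $ k) (F (cutoff n b p t H k))"
proof (cases rule: equilibrium_cases)
  case indifferent
  then show ?thesis using F_upper_Cons_indifferent[OF _ e, of D] by linarith
next
  case cutoff
  then have "upper thr (D # H) k \<le> cutoff n b p t H k" by simp
  then show ?thesis using F_mono by (simp add: le_max_iff_disj)
qed

lemma F_upper_Cons_last:
  assumes "t = 1"
  shows "F (upper thr (D # H) k) \<le> F (cutoff n b p t H k)"
  by (cases rule: equilibrium_cases) (use assms in \<open>auto intro: F_mono\<close>)

text \<open>By the intermediate value theorem, \<open>F\<close> takes the value prescribed by the
  scalar equation at some point below the current bound. By \<open>small\<close> this value exceeds
  \<open>F\<close> at the cutoff, so utility there is non-negative. Once a solution exists, an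
  equilibrium has to play one.\<close>

lemma indifferent_if_cutoff_small:
  assumes "2 \<le> t" and \<Delta>: "0 \<le> p (t - 1) - p t"
    and small: "\<And>k. 0 < unsold n b H k \<and> F (cutoff n b p t H k) <
      F (upper thr H k) * (1 - s * (p (t - 1) - p t) * \<alpha> $ k / unsold n b H k)"
  shows "indifferent f E n b p t H (upper thr H) (thr H)"
proof -
  have "\<exists>\<theta>. \<theta> \<le> upper thr H k \<and> cutoff n b p t H k \<le> \<theta> \<and>
      unsold n b H k * ((F (upper thr H k) - F \<theta>) / F (upper thr H k)) = s * (p (t - 1) - p t) * \<alpha> $ k" for k
  proof -
    \<comment> \<open>The purchase probability that the scalar equation of block \<open>k\<close>
      prescribes.\<close>
    define q where "q = s * (p (t - 1) - p t) * \<alpha> $ k / unsold n b H k"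
    let ?w = "F (upper thr H k)"
    have q: "0 \<le> q"
      unfolding q_def using small[of k] s_pos \<alpha>_pos[of k] \<Delta> by (intro divide_nonneg_pos mult_nonneg_nonneg) auto
    have lt: "F (cutoff n b p t H k) < ?w * (1 - q)"
      using small[of k] by (simp add: q_def)
    have "0 < ?w * (1 - q)"
      using lt F_ge_0[of "cutoff n b p t H k"] by linarith
    then have w: "0 < ?w" and q1: "0 < 1 - q"
      using F_ge_0[of "upper thr H k"] by (auto simp: zero_less_mult_iff)
    have u: "0 \<le> upper thr H k"
      using w F_eq_0[of "upper thr H k"] by (cases "upper thr H k \<le> 0") auto
    have "?w * (1 - q) \<le> ?w" using w q by (simp add: mult_le_cancel_left1)
    then obtain \<theta> where \<theta>: "0 \<le> \<theta>" "\<theta> \<le> upper thr H k" "F \<theta> = ?w * (1 - q)"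
      using IVT'[of F 0 "?w * (1 - q)" "upper thr H k"] u \<open>0 < ?w * (1 - q)\<close> F_eq_0[of 0] continuous_on_F
      by auto
    have "cutoff n b p t H k \<le> \<theta>"
      using lt \<theta>(3) F_mono[of \<theta> "cutoff n b p t H k"] by linarith
    moreover have "unsold n b H k * ((?w - F \<theta>) / ?w) = s * (p (t - 1) - p t) * \<alpha> $ k"
    proof -
      have "(?w - F \<theta>) / ?w = q" using w \<theta>(3) by (simp add: field_simps)
      then show ?thesis using small[of k] by (simp add: q_def)
    qed
    ultimately show ?thesis using \<theta>(2) by blast
  qed
  then obtain \<theta> where "\<And>k. \<theta> k \<le> upper thr H k \<and> cutoff n b p t H k \<le> \<theta> k \<and>
      unsold n b H k * ((F (upper thr H k) - F (\<theta> k)) / F (upper thr H k)) = s * (p (t - 1) - p t) * \<alpha> $ k"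
    by metis
  then have "indifferent f E n b p t H (upper thr H) \<theta>"
    by (simp add: indifferent_iff[OF ok H])
  then show ?thesis
    by (cases rule: equilibrium_cases) (use assms(1) in auto)
qed

end

end

context balanced_network
begin

section \<open>The limit along typical valuations\<close>

text \<open>
  The limit fraction of buyers who have bought before round \<open>t\<close>; before the last round, this is
  \<open>s * (p t - p T)\<close> as long as the prices do not outrun the demand \<open>1 - F (p T)\<close>.
\<close>
definition mass :: "(nat \<Rightarrow> real) \<Rightarrow> nat \<Rightarrow> nat \<Rightarrow> real" where
  "mass p T t = (if t = 0 then 1 - F (p T) else min (s * (p t - p T)) (1 - F (p T)))"

text \<open>The bound is uniform in the level \<open>x\<close> because the levels of interest are
  thresholds that themselves depend on \<open>v\<close>.\<close>

definition typical :: "nat \<Rightarrow> (nat \<Rightarrow> 'm) \<Rightarrow> real \<Rightarrow> (nat \<Rightarrow> real) \<Rightarrow> bool" where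
  "typical n b e v \<longleftrightarrow> (\<forall>i<n. v i < 1) \<and>
    (\<forall>k x. \<bar>real (card {i. i < n \<and> b i = k \<and> v i < x}) / real n - \<alpha> $ k * F x\<bar> \<le> e)"

lemma unsold_typical:
  assumes "typical n b e v"
  shows "\<bar>unsold n b (history n b thr v r) k - \<alpha> $ k * F (upper thr (history n b thr v r) k)\<bar> \<le> e"
  using assms unfolding typical_def by (subst unsold_history) auto

section \<open>Limits round by round along markets with vanishing deviation \<open>e\<close>\<close>

context
  fixes n :: "'i \<Rightarrow> nat" and b :: "'i \<Rightarrow> nat \<Rightarrow> 'm" and thr :: "'i \<Rightarrow> nat set list \<Rightarrow> 'm \<Rightarrow> real"
    and v :: "'i \<Rightarrow> nat \<Rightarrow> real" and e :: "'i \<Rightarrow> real" and p :: "nat \<Rightarrow> real" and T :: nat and \<Phi> :: "'i filter"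
  assumes ok: "\<And>i. blocks_ok (n i) (b i)"
    and eq: "\<And>i. equilibrium f E (n i) (b i) T p (thr i)"
    and spread: "\<And>i. typical (n i) (b i) (e i) (v i)"
    and e: "(e \<longlongrightarrow> 0) \<Phi>"
    and p: "nondecreasing_prices T p"
begin

abbreviation hist :: "'i \<Rightarrow> nat \<Rightarrow> nat set list" where
  "hist i r \<equiv> history (n i) (b i) (thr i) (v i) r"

abbreviation up :: "'i \<Rightarrow> nat \<Rightarrow> 'm \<Rightarrow> real" where
  "up i r k \<equiv> upper (thr i) (hist i r) k"

lemma unsold_tendsto:
  assumes "((\<lambda>i. F (up i r k)) \<longlongrightarrow> w) \<Phi>"
  shows "((\<lambda>i. unsold (n i) (b i) (hist i r) k) \<longlongrightarrow> \<alpha> $ k * w) \<Phi>"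
proof -
  have "((\<lambda>i. unsold (n i) (b i) (hist i r) k - \<alpha> $ k * F (up i r k)) \<longlongrightarrow> 0) \<Phi>"
    by (rule Lim_null_comparison[OF _ e]) (simp add: unsold_typical[OF spread])
  from tendsto_add[OF this tendsto_mult_left[OF assms, of "\<alpha> $ k"]] show ?thesis by simp
qed

text \<open>The induction step over the rounds. If the demand \<open>Q\<close> is exhausted, nothing
  more is sold. Otherwise the effective price is \<open>p T\<close>, and the round sells the rest of
  the demand if it is the last one or if the next price outruns the demand; in the remaining case
  the threshold equations are eventually solvable and fix the sales.\<close>

lemma upper_step_tendsto:
  assumes t: "1 \<le> t" "t + r = T"
    and IH: "\<And>k. ((\<lambda>i. F (up i r k)) \<longlongrightarrow> 1 - mass p T t) \<Phi>"
  shows "((\<lambda>i. F (up i (Suc r) k)) \<longlongrightarrow> 1 - mass p T (t - 1)) \<Phi>"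
proof -
  define Q where "Q = 1 - F (p T)"
  define c where "c i = cutoff (n i) (b i) p t (hist i r)" for i
  define \<Delta> where "\<Delta> = p (t - 1) - p t"
  note step = ok bought_history eq t(1)
  have len: "t + length (hist i r) = T" for i using t by simp
  have up_Suc: "up i (Suc r) k = upper (thr i) (buyers (n i) (b i) (thr i) (v i) (hist i r) # hist i r) k" for i k
    by simp
  have pt: "p T \<le> p t" by (rule nondecreasing_pricesD[OF p]) (use t in auto)
  have m: "mass p T t = min (s * (p t - p T)) Q" using t by (simp add: mass_def Q_def)
  have un: "((\<lambda>i. unsold (n i) (b i) (hist i r) k) \<longlongrightarrow> \<alpha> $ k * (1 - mass p T t)) \<Phi>" for k
    by (rule unsold_tendsto[OF IH])
  have "((\<lambda>i. c i k) \<longlongrightarrow> p t - (\<Sum>h\<in>UNIV. E $ k $ h * (\<alpha> $ h - \<alpha> $ h * (1 - mass p T t)))) \<Phi>" for k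
    unfolding c_def cutoff_def by (intro tendsto_intros un)
  \<comment> \<open>Balance makes the limit cutoff the same for all blocks: the price minus the
    influence \<open>mass p T t / s\<close> of the buyers so far.\<close>
  also have "(\<lambda>k. p t - (\<Sum>h\<in>UNIV. E $ k $ h * (\<alpha> $ h - \<alpha> $ h * (1 - mass p T t)))) = (\<lambda>k. p t - mass p T t / s)"
  proof
    fix k
    have "(\<Sum>h\<in>UNIV. E $ k $ h * (\<alpha> $ h - \<alpha> $ h * (1 - mass p T t))) = mass p T t * (\<Sum>h\<in>UNIV. E $ k $ h * \<alpha> $ h)"
      by (simp add: sum_distrib_left algebra_simps)
    then show "p t - (\<Sum>h\<in>UNIV. E $ k $ h * (\<alpha> $ h - \<alpha> $ h * (1 - mass p T t))) = p t - mass p T t / s"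
      by (simp add: balanced)
  qed
  finally have "((\<lambda>i. c i k) \<longlongrightarrow> p t - mass p T t / s) \<Phi>" for k .
  then have Fc: "((\<lambda>i. F (c i k)) \<longlongrightarrow> F (p t - mass p T t / s)) \<Phi>" for k
    using isCont_F isCont_tendsto_compose by blast
  \<comment> \<open>The influence never pushes the effective price below \<open>p T\<close>, so
    buying at the limit cutoff leaves at least the share \<open>1 - Q\<close> unsold.\<close>
  have "mass p T t \<le> s * (p t - p T)" by (simp add: m)
  then have "p T \<le> p t - mass p T t / s"
    using s_pos by (simp add: field_simps)
  then have Fa: "1 - Q \<le> F (p t - mass p T t / s)"
    using F_mono by (simp add: Q_def)
  have upper: "F (up i (Suc r) k) \<le> F (up i r k)" for i
    by (simp add: F_mono)
  have lower: "min (F (up i r k)) (F (c i k)) \<le> F (up i (Suc r) k)" for i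
    unfolding up_Suc c_def by (rule F_upper_Cons_ge[OF ok bought_history eq t(1) len])
  have lower_tendsto: "((\<lambda>i. min (F (up i r k)) (F (c i k))) \<longlongrightarrow> min (1 - mass p T t) (F (p t - mass p T t / s))) \<Phi>"
    by (intro tendsto_min IH Fc)
  consider (sold_out) "Q \<le> s * (p t - p T)" | (selling) "s * (p t - p T) < Q" by linarith
  then show ?thesis
  proof cases
    case sold_out
    then have mt: "mass p T t = Q" by (simp add: m)
    have "mass p T (t - 1) = Q"
    proof (cases "t = 1")
      case False
      then have "p t \<le> p (t - 1)" by (intro nondecreasing_pricesD[OF p]) (use t in auto)
      then have "Q \<le> s * (p (t - 1) - p T)"
        using sold_out s_pos by (smt (verit) mult_left_mono)
      then show ?thesis using False t by (simp add: mass_def Q_def)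
    qed (simp add: mass_def Q_def)
    moreover have "((\<lambda>i. F (up i (Suc r) k)) \<longlongrightarrow> 1 - Q) \<Phi>"
    \<comment> \<open>Everybody willing to pay \<open>p T\<close> has bought already: the bound
      cannot rise, and the effective price keeps it from falling.\<close>
    proof (rule tendsto_sandwich[OF always_eventually always_eventually])
      show "((\<lambda>i. min (F (up i r k)) (F (c i k))) \<longlongrightarrow> 1 - Q) \<Phi>"
        using lower_tendsto Fa mt by (simp add: min_absorb1)
      show "((\<lambda>i. F (up i r k)) \<longlongrightarrow> 1 - Q) \<Phi>" using IH mt by simp
    qed (use upper lower in auto)
    ultimately show ?thesis by simp
  next
    case selling
    then have mt: "mass p T t = s * (p t - p T)" by (simp add: m)
    have pc: "p t - mass p T t / s = p T" using s_pos by (simp add: mt)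
    have Fc': "((\<lambda>i. F (c i k)) \<longlongrightarrow> 1 - Q) \<Phi>" for k
      using Fc[of k] unfolding pc by (simp add: Q_def)
    have lower_tendsto': "((\<lambda>i. min (F (up i r k)) (F (c i k))) \<longlongrightarrow> 1 - Q) \<Phi>"
      using lower_tendsto selling unfolding pc by (simp add: Q_def mt min_absorb2)
    consider (last) "t = 1" | (go) "2 \<le> t" "s * (p (t - 1) - p T) < Q" | (stop) "2 \<le> t" "Q \<le> s * (p (t - 1) - p T)"
      using t by linarith
    then show ?thesis
    proof cases
      case last
      have "((\<lambda>i. F (up i (Suc r) k)) \<longlongrightarrow> 1 - Q) \<Phi>"
      proof (rule tendsto_sandwich[OF always_eventually always_eventually lower_tendsto' Fc'])
        show "\<forall>i. F (up i (Suc r) k) \<le> F (c i k)"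
          unfolding up_Suc c_def by (intro allI F_upper_Cons_last[OF ok bought_history eq t(1) len last])
      qed (use lower in auto)
      then show ?thesis using last by (simp add: mass_def Q_def)
    next
      \<comment> \<open>Solvability of the threshold equations is not decided here. Indifference
        would sell at least the remaining demand in the limit, and the cutoff sells exactly that, so
        both regimes give the upper bound \<open>1 - Q\<close>.\<close>
      case stop
      have "((\<lambda>i. max (F (up i r k) - s * \<Delta> + e i / \<alpha> $ k) (F (c i k))) \<longlongrightarrow> max (1 - mass p T t - s * \<Delta> + 0 / \<alpha> $ k) (1 - Q)) \<Phi>"
        using \<alpha>_pos[of k] by (intro tendsto_intros IH Fc' e) auto
      also have "max (1 - mass p T t - s * \<Delta> + 0 / \<alpha> $ k) (1 - Q) = 1 - Q"
        using stop by (simp add: mt \<Delta>_def algebra_simps)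
      finally have upper_tendsto: "((\<lambda>i. max (F (up i r k) - s * \<Delta> + e i / \<alpha> $ k) (F (c i k))) \<longlongrightarrow> 1 - Q) \<Phi>" .
      have "((\<lambda>i. F (up i (Suc r) k)) \<longlongrightarrow> 1 - Q) \<Phi>"
      proof (rule tendsto_sandwich[OF always_eventually always_eventually lower_tendsto' upper_tendsto])
        show "\<forall>i. F (up i (Suc r) k) \<le> max (F (up i r k) - s * \<Delta> + e i / \<alpha> $ k) (F (c i k))"
          unfolding up_Suc c_def \<Delta>_def
          by (intro allI F_upper_Cons_le_max[OF ok bought_history eq t(1) len] unsold_typical spread)
      qed (use lower in auto)
      moreover have "mass p T (t - 1) = Q" using stop by (simp add: mass_def Q_def)
      ultimately show ?thesis by simp
    next
      case go
      have mt': "1 - mass p T (t - 1) = 1 - mass p T t - s * \<Delta>"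
      proof -
        have "mass p T (t - 1) = s * (p (t - 1) - p T)" using go by (simp add: mass_def Q_def)
        then show ?thesis by (simp add: mt \<Delta>_def algebra_simps)
      qed
      have \<Delta>: "0 \<le> \<Delta>"
        using nondecreasing_pricesD[OF p, of "t - 1" t] go t by (simp add: \<Delta>_def)
      have mlt: "mass p T (t - 1) < Q" using go by (simp add: mass_def Q_def)
      have Q1: "Q \<le> 1" using F_ge_0 by (simp add: Q_def)
      have "0 \<le> s * \<Delta>" using \<Delta> s_pos by simp
      then have m1: "mass p T t < 1" using mt' mlt Q1 by linarith
      have "eventually (\<lambda>i. \<forall>k. 0 < unsold (n i) (b i) (hist i r) k) \<Phi>"
        by (intro eventually_all_finite order_tendstoD(1)[OF un]) (use m1 \<alpha>_pos in simp)
      \<comment> \<open>The gap between the prescribed value of \<open>F\<close> and its value at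
        the cutoff tends to \<open>Q - mass p T (t - 1)\<close>, which is positive in this case;
        hence the threshold equations are eventually solvable.\<close>
      moreover have "eventually (\<lambda>i. \<forall>k. 0 < F (up i r k) * (1 - s * \<Delta> * \<alpha> $ k / unsold (n i) (b i) (hist i r) k) - F (c i k)) \<Phi>"
      proof (intro eventually_all_finite)
        fix k
        have \<alpha>1: "\<alpha> $ k * (1 - mass p T t) \<noteq> 0" using m1 \<alpha>_pos[of k] by simp
        have "((\<lambda>i. F (up i r k) * (1 - s * \<Delta> * \<alpha> $ k / unsold (n i) (b i) (hist i r) k) - F (c i k)) \<longlongrightarrow>
            (1 - mass p T t) * (1 - s * \<Delta> * \<alpha> $ k / (\<alpha> $ k * (1 - mass p T t))) - (1 - Q)) \<Phi>"
          by (intro tendsto_intros IH Fc' un \<alpha>1)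
        also have "(1 - mass p T t) * (1 - s * \<Delta> * \<alpha> $ k / (\<alpha> $ k * (1 - mass p T t))) - (1 - Q) = Q - mass p T (t - 1)"
        proof -
          have "s * \<Delta> * \<alpha> $ k / (\<alpha> $ k * (1 - mass p T t)) = s * \<Delta> / (1 - mass p T t)"
            using \<alpha>1 by simp
          moreover have "(1 - mass p T t) * (1 - s * \<Delta> / (1 - mass p T t)) = 1 - mass p T t - s * \<Delta>"
            using m1 by (simp add: right_diff_distrib)
          ultimately show ?thesis using mt' by simp
        qed
        finally show "eventually (\<lambda>i. 0 < F (up i r k) * (1 - s * \<Delta> * \<alpha> $ k / unsold (n i) (b i) (hist i r) k) - F (c i k)) \<Phi>"
          using mlt by (intro order_tendstoD(1)) auto
      qed
      ultimately have ind: "eventually (\<lambda>i. indifferent f E (n i) (b i) p t (hist i r) (upper (thr i) (hist i r)) (thr i (hist i r))) \<Phi>"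
      proof eventually_elim
        case (elim i)
        show ?case
          by (rule indifferent_if_cutoff_small[OF ok bought_history eq t(1) len go(1)])
            (use elim \<Delta> in \<open>auto simp: c_def \<Delta>_def\<close>)
      qed
      have "((\<lambda>i. F (up i (Suc r) k) - (F (up i r k) - s * \<Delta>)) \<longlongrightarrow> 0) \<Phi>"
      proof (rule Lim_null_comparison)
        show "eventually (\<lambda>i. norm (F (up i (Suc r) k) - (F (up i r k) - s * \<Delta>)) \<le> e i / \<alpha> $ k) \<Phi>"
          using ind
        proof eventually_elim
          case (elim i)
          then show ?case
            unfolding up_Suc \<Delta>_def real_norm_def
            by (intro F_upper_Cons_indifferent[OF ok bought_history eq t(1) len] unsold_typical spread)
        qed
        show "((\<lambda>i. e i / \<alpha> $ k) \<longlongrightarrow> 0) \<Phi>"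
          using tendsto_divide[OF e tendsto_const[of "\<alpha> $ k"]] \<alpha>_pos[of k] by simp
      qed
      from tendsto_add[OF this tendsto_diff[OF IH[of k] tendsto_const[of "s * \<Delta>"]]]
      show ?thesis unfolding mt' by simp
    qed
  qed
qed

lemma upper_tendsto:
  assumes "1 \<le> T" "r \<le> T"
  shows "((\<lambda>i. F (up i r k)) \<longlongrightarrow> 1 - mass p T (T - r)) \<Phi>"
  using assms(2)
proof (induction r arbitrary: k)
  case 0
  have "mass p T T = 0" using assms(1) F_le_1 by (simp add: mass_def)
  then show ?case by (simp add: F_eq_1)
next
  case (Suc r)
  then have "((\<lambda>i. F (up i (Suc r) k)) \<longlongrightarrow> 1 - mass p T (T - r - 1)) \<Phi>"
    by (intro upper_step_tendsto) auto
  then show ?case by simp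
qed

text \<open>The sales of a round are the drop in the number of remaining buyers, and the unsold
  fractions of all blocks add up to \<open>1 - mass\<close> in the limit since the block fractions
  sum to 1.\<close>

lemma card_buyers_tendsto:
  assumes "1 \<le> t" "t \<le> T"
  shows "((\<lambda>i. real (card (buyers (n i) (b i) (thr i) (v i) (hist i (T - t)))) / real (n i))
    \<longlongrightarrow> mass p T (t - 1) - mass p T t) \<Phi>"
proof -
  let ?rest = "\<lambda>i r. \<Sum>k\<in>UNIV. unsold (n i) (b i) (hist i r) k"
  have rest: "((\<lambda>i. ?rest i r) \<longlongrightarrow> 1 - mass p T (T - r)) \<Phi>" if "r \<le> T" for r
  proof -
    have "((\<lambda>i. ?rest i r) \<longlongrightarrow> (\<Sum>k\<in>UNIV. \<alpha> $ k * (1 - mass p T (T - r)))) \<Phi>"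
      using assms that by (intro tendsto_intros unsold_tendsto upper_tendsto) auto
    then show ?thesis by (simp add: \<alpha>_sum flip: sum_distrib_right)
  qed
  have rest_card: "?rest i r = real (card ({..<n i} - bought (hist i r))) / real (n i)" for i r
    using sum_blocks[of "{..<n i} - bought (hist i r)" "\<lambda>k. 1 / real (n i)" "b i"]
    by (auto simp: unsold_def intro!: sum.cong arg_cong[where f=card])
  have "real (card (buyers (n i) (b i) (thr i) (v i) (hist i r))) / real (n i) = ?rest i r - ?rest i (Suc r)" for i r
  proof -
    let ?B = "buyers (n i) (b i) (thr i) (v i) (hist i r)"
    have "card ({..<n i} - bought (hist i (Suc r))) + card ?B = card ({..<n i} - bought (hist i r))"
      by (subst card_Un_disjoint[symmetric]) (auto simp: bought_Cons buyers_def intro!: arg_cong[where f=card])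
    then show ?thesis
      unfolding rest_card by (simp add: diff_divide_distrib[symmetric] flip: of_nat_add)
  qed
  \<comment> \<open>Before round \<open>t\<close> there have been \<open>T - t\<close> rounds. The
    state after round \<open>t\<close> is the one indexed by \<open>t - 1\<close>, with index 0 for
    the end of the game.\<close>
  moreover have "Suc (T - t) \<le> T" "T - (T - t) = t" "T - Suc (T - t) = t - 1" using assms by auto
  ultimately show ?thesis
    using tendsto_diff[OF rest[of "T - t"] rest[of "Suc (T - t)"]] by simp
qed

end

end

section \<open>Concentration of the empirical distributions\<close>

context unit_density
begin

lemma prob_space_valuations: "prob_space (valuations f n)"
  unfolding valuations_def by (intro prob_space_PiM V.prob_space_axioms)

lemma component_measurable [measurable]: "i < n \<Longrightarrow> (\<lambda>v. v i) \<in> valuations f n \<rightarrow>\<^sub>M borel"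
  using measurable_component_singleton[of i "{..<n}" "\<lambda>_. valuation f"]
  unfolding valuations_def measurable_cong_sets[OF refl V.events_eq_borel] by simp

lemma distr_component: "i < n \<Longrightarrow> distr (valuations f n) (valuation f) (\<lambda>v. v i) = valuation f"
  unfolding valuations_def by (rule distr_PiM_component[where M = "\<lambda>_. valuation f"]) (auto intro: V.prob_space_axioms)

lemma AE_valuations_lt_1: "AE v in valuations f n. \<forall>i<n. v i < 1"
proof -
  have "AE v in valuations f n. v i < 1" if "i < n" for i
    unfolding valuations_def
    by (rule AE_PiM_component[where M = "\<lambda>_. valuation f" and P = "\<lambda>x. x < 1"])
      (use that AE_valuation in \<open>auto intro: V.prob_space_axioms elim!: eventually_mono\<close>)
  then have "AE v in valuations f n. \<forall>i\<in>{..<n}. v i < 1"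
    by (subst AE_ball_countable) auto
  then show ?thesis by (simp only: Ball_def lessThan_iff)
qed

text \<open>The joint law is a product by definition. What is left is to replace the factors'
  sigma-algebras by \<open>borel\<close> and to note that restriction is the identity on the product
  space.\<close>

lemma indep_components:
  assumes "0 < n"
  shows "prob_space.indep_vars (valuations f n) (\<lambda>_. borel) (\<lambda>i v. v i) {..<n}"
proof -
  interpret P: prob_space "valuations f n" by (rule prob_space_valuations)
  have "distr (valuations f n) (PiM {..<n} (\<lambda>_. borel)) (\<lambda>v. restrict v {..<n}) = 
      PiM {..<n} (\<lambda>i. distr (valuations f n) borel (\<lambda>v. v i))"
  proof -
    have "distr (valuations f n) (PiM {..<n} (\<lambda>_. borel)) (\<lambda>v. restrict v {..<n}) = distr (valuations f n) (valuations f n) (\<lambda>v. v)"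
      by (intro distr_cong) (auto simp: valuations_def space_PiM PiE_def extensional_restrict cong: sets_PiM_cong)
    also have "\<dots> = PiM {..<n} (\<lambda>i. valuation f)" by (simp add: valuations_def)
    also have "\<dots> = PiM {..<n} (\<lambda>i. distr (valuations f n) borel (\<lambda>v. v i))"
    proof (intro PiM_cong refl)
      fix i assume "i \<in> {..<n}"
      then have "valuation f = distr (valuations f n) (valuation f) (\<lambda>v. v i)"
        using distr_component by simp
      also have "\<dots> = distr (valuations f n) borel (\<lambda>v. v i)"
        by (intro distr_cong) auto
      finally show "valuation f = distr (valuations f n) borel (\<lambda>v. v i)" .
    qed
    finally show ?thesis .
  qed
  then show ?thesis
    using assms by (subst P.indep_vars_iff_distr_eq_PiM') (auto simp: restrict_def)
qed

lemma prob_component_less: "i < n \<Longrightarrow> measure (valuations f n) {v \<in> space (valuations f n). v i < x} = F x"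
proof -
  assume i: "i < n"
  have "measure (valuation f) {..<x} = measure (distr (valuations f n) (valuation f) (\<lambda>v. v i)) {..<x}"
    by (simp add: distr_component[OF i])
  also have "\<dots> = measure (valuations f n) ((\<lambda>v. v i) -` {..<x} \<inter> space (valuations f n))"
    using component_measurable[OF i] by (intro measure_distr) auto
  also have "(\<lambda>v. v i) -` {..<x} \<inter> space (valuations f n) = {v \<in> space (valuations f n). v i < x}"
    by auto
  finally show ?thesis by (simp add: measure_lessThan)
qed

text \<open>Hoeffding's inequality for the indicators of being in block \<open>k\<close> with
  valuation below \<open>x\<close>. Buyers of other blocks contribute the constant 0, so the sum has
  \<open>n\<close> terms for every block.\<close>

lemma empirical_deviation:
  assumes "0 < n" "0 \<le> \<epsilon>"
  shows "measure (valuations f n) {v \<in> space (valuations f n).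
      real n * \<epsilon> \<le> \<bar>real (card {i. i < n \<and> b i = k \<and> v i < x}) - real (card {i. i < n \<and> b i = k}) * F x\<bar>}
    \<le> 2 * exp (- 2 * real n * \<epsilon>\<^sup>2)"
proof -
  interpret P: prob_space "valuations f n" by (rule prob_space_valuations)
  define X where "X i v = (if b i = k \<and> v i < x then 1 else 0 :: real)" for i and v :: "nat \<Rightarrow> real"
  interpret H: Hoeffding_ineq "valuations f n" "{..<n}" X "\<lambda>_. 0" "\<lambda>_. 1" "\<Sum>i<n. P.expectation (X i)"
  proof unfold_locales
    show "P.indep_vars (\<lambda>_. borel) X {..<n}"
      unfolding X_def by (rule P.indep_vars_compose2[OF indep_components[OF assms(1)]]) auto
  qed (auto simp: X_def)
  have "P.expectation (X i) = (if b i = k then F x else 0)" if "i < n" for i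
  proof -
    have "P.expectation (X i) = P.expectation (indicator (if b i = k then {v \<in> space (valuations f n). v i < x} else {}))"
      by (intro Bochner_Integration.integral_cong) (auto simp: X_def)
    also have "\<dots> = (if b i = k then F x else 0)"
      using prob_component_less[OF that] by (simp add: Int_absorb2)
    finally show ?thesis .
  qed
  then have "(\<Sum>i<n. P.expectation (X i)) = real (card {i. i < n \<and> b i = k}) * F x"
    by (simp add: sum.If_cases Int_def)
  moreover have "(\<Sum>i<n. X i v) = real (card {i. i < n \<and> b i = k \<and> v i < x})" for v
    by (simp add: X_def sum.If_cases Int_def)
  moreover have "- 2 * (real n * \<epsilon>)\<^sup>2 / (\<Sum>i<n. (1 - 0)\<^sup>2) = - 2 * real n * \<epsilon>\<^sup>2"
    using assms by (simp add: power2_eq_square)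
  ultimately show ?thesis
    using H.Hoeffding_ineq_abs_ge[of "real n * \<epsilon>"] assms by simp
qed

text \<open>The grid consists of quantiles of the continuous function \<open>F\<close> at the levels
  \<open>l / K\<close> with \<open>1 / K < \<epsilon>\<close>.\<close>

lemma F_grid:
  assumes "0 < \<epsilon>"
  obtains X where "finite X"
    "\<And>x. F x < 1 \<Longrightarrow> \<exists>g\<in>X. x \<le> g \<and> F g \<le> F x + \<epsilon>"
    "\<And>x. 0 < F x \<Longrightarrow> \<exists>g\<in>X. g \<le> x \<and> F x - \<epsilon> \<le> F g"
proof -
  obtain M :: nat where M: "inverse (real (Suc M)) < \<epsilon>"
    using reals_Archimedean[OF assms] by auto
  define K where "K = Suc M"
  have K: "0 < real K" "1 / real K < \<epsilon>" using M by (auto simp: K_def inverse_eq_divide)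
  have "\<exists>g. F g = real l / real K" if "l \<le> K" for l
    using IVT'[of F 0 "real l / real K" 1] that K F_eq_0[of 0] F_eq_1[of 1] continuous_on_F by auto
  then obtain g where g: "\<And>l. l \<le> K \<Longrightarrow> F (g l) = real l / real K" by metis
  show ?thesis
  proof
    show "finite (g ` {..K})" by simp
  next
    fix x assume x: "F x < 1"
    \<comment> \<open>Rounded up strictly, and in the second half down strictly: only a strict
      inequality between values of \<open>F\<close> determines the order of the points.\<close>
    define l where "l = nat (floor (real K * F x)) + 1"
    have nn: "0 \<le> real K * F x" using K F_ge_0 by simp
    have l1: "real K * F x < real l" "real l \<le> real K * F x + 1"
      using nn unfolding l_def by linarith+
    have "real K * F x < real K" using x K by simp
    then have "l \<le> K" using l1 by linarith
    have "real K * F x < real K * F (g l)" "real K * F (g l) \<le> real K * (F x + \<epsilon>)"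
      using l1 K g[OF \<open>l \<le> K\<close>] by (auto simp: field_simps)
    then have "F x < F (g l)" "F (g l) \<le> F x + \<epsilon>"
      using K by (simp_all only: mult_less_cancel_left_pos mult_le_cancel_left_pos)
    moreover have "x \<le> g l" using F_mono[of "g l" x] \<open>F x < F (g l)\<close> by linarith
    ultimately show "\<exists>g\<in>g ` {..K}. x \<le> g \<and> F g \<le> F x + \<epsilon>" using \<open>l \<le> K\<close> by auto
  next
    fix x assume x: "0 < F x"
    define l where "l = nat (ceiling (real K * F x)) - 1"
    have pos: "0 < real K * F x" using K x by simp
    then have "nat (ceiling (real K * F x)) \<ge> 1" by linarith
    then have "real l = of_int (ceiling (real K * F x)) - 1"
      using pos unfolding l_def by simp
    then have l1: "real l < real K * F x" "real K * F x - 1 \<le> real l" by linarith+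
    have "real K * F x \<le> real K" using F_le_1[of x] K by (simp add: mult_left_le)
    then have "l \<le> K" using l1 by linarith
    have "real K * F (g l) < real K * F x" "real K * (F x - \<epsilon>) \<le> real K * F (g l)"
      using l1 K g[OF \<open>l \<le> K\<close>] by (auto simp: field_simps)
    then have "F (g l) < F x" "F x - \<epsilon> \<le> F (g l)"
      using K by (simp_all only: mult_less_cancel_left_pos mult_le_cancel_left_pos)
    moreover have "g l \<le> x" using F_mono[of x "g l"] \<open>F (g l) < F x\<close> by linarith
    ultimately show "\<exists>g\<in>g ` {..K}. g \<le> x \<and> F x - \<epsilon> \<le> F g" using \<open>l \<le> K\<close> by auto
  qed
qed

end

context balanced_network
begin

lemma \<alpha>_le_1: "\<alpha> $ k \<le> 1"
proof -
  have "\<alpha> $ k \<le> (\<Sum>k\<in>UNIV. \<alpha> $ k)"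
    by (rule member_le_sum) (auto intro: less_imp_le \<alpha>_pos)
  then show ?thesis by (simp add: \<alpha>_sum)
qed

text \<open>Both the empirical count and \<open>F\<close> are monotone, so an arbitrary level is
  compared with a neighbouring grid point: one \<open>\<epsilon>\<close> for the deviation there and
  one for the grid spacing. Where \<open>F\<close> is 1 or 0 the block size and 0 serve as
  bounds.\<close>

lemma typical_if_typical_on_grid:
  assumes ok: "blocks_ok n b" and "0 < \<epsilon>" and v: "\<forall>i<n. v i < 1"
    and up: "\<And>x. F x < 1 \<Longrightarrow> \<exists>g\<in>X. x \<le> g \<and> F g \<le> F x + \<epsilon>"
    and dn: "\<And>x. 0 < F x \<Longrightarrow> \<exists>g\<in>X. g \<le> x \<and> F x - \<epsilon> \<le> F g"
    and X: "\<And>g k. g \<in> X \<Longrightarrow> \<bar>real (card {i. i < n \<and> b i = k \<and> v i < g}) / real n - \<alpha> $ k * F g\<bar> \<le> \<epsilon>"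
  shows "typical n b (2 * \<epsilon>) v"
  unfolding typical_def
proof (intro conjI[OF v] allI)
  fix k x
  define C where "C y = real (card {i. i < n \<and> b i = k \<and> v i < y}) / real n" for y
  have C_mono: "C x \<le> C y" if "x \<le> y" for x y
    using that by (auto simp: C_def intro!: divide_right_mono card_mono)
  have "C x \<le> real (card {i. i < n \<and> b i = k}) / real n"
    by (auto simp: C_def intro!: divide_right_mono card_mono)
  then have C_le: "C x \<le> \<alpha> $ k" using ok by (simp add: blocks_ok_def)
  have scale: "\<alpha> $ k * F y \<le> \<alpha> $ k * F z + \<epsilon>" if "F y \<le> F z + \<epsilon>" for y z
  proof -
    have "\<alpha> $ k * F y \<le> \<alpha> $ k * (F z + \<epsilon>)" using that \<alpha>_pos[of k] by simp
    also have "\<dots> \<le> \<alpha> $ k * F z + \<epsilon>"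
      using \<alpha>_le_1[of k] \<open>0 < \<epsilon>\<close> by (simp add: distrib_left mult_left_le_one_le less_imp_le[OF \<alpha>_pos])
    finally show ?thesis .
  qed
  have "C x \<le> \<alpha> $ k * F x + 2 * \<epsilon>"
  proof (cases "F x < 1")
    case True
    then obtain g where g: "g \<in> X" "x \<le> g" "F g \<le> F x + \<epsilon>" using up by blast
    then show ?thesis using X[OF g(1), of k] C_mono[OF g(2)] scale[OF g(3)] unfolding C_def by linarith
  next
    case False
    then have "F x = 1" using F_le_1[of x] by simp
    then show ?thesis using C_le \<open>0 < \<epsilon>\<close> by simp
  qed
  moreover have "\<alpha> $ k * F x - 2 * \<epsilon> \<le> C x"
  proof (cases "0 < F x")
    case True
    then obtain g where g: "g \<in> X" "g \<le> x" "F x - \<epsilon> \<le> F g" using dn by blast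
    have "F x \<le> F g + \<epsilon>" using g(3) by simp
    then show ?thesis using X[OF g(1), of k] C_mono[OF g(2)] scale[of x g] unfolding C_def by linarith
  next
    case False
    then have "F x = 0" using F_ge_0[of x] by simp
    moreover have "0 \<le> C x" by (simp add: C_def)
    ultimately show ?thesis using \<open>0 < \<epsilon>\<close> by simp
  qed
  ultimately show "\<bar>real (card {i. i < n \<and> b i = k \<and> v i < x}) / real n - \<alpha> $ k * F x\<bar> \<le> 2 * \<epsilon>"
    unfolding C_def by linarith
qed

text \<open>Union bound over the blocks and the grid points. The bound involves the market only
  through \<open>n\<close>, so one \<open>n0\<close> serves all block assignments. The measurable
  set \<open>A\<close> stands in for the event \<open>typical\<close>.\<close>

lemma eventually_typical:
  assumes "0 < \<epsilon>" "0 < \<delta>"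
  shows "\<exists>n0. \<forall>n\<ge>n0. \<forall>b. blocks_ok n b \<longrightarrow>
    (\<exists>A\<in>sets (valuations f n). 1 - \<delta> \<le> measure (valuations f n) A \<and> (\<forall>v\<in>A. typical n b \<epsilon> v))"
proof -
  define \<epsilon>' where "\<epsilon>' = \<epsilon> / 2"
  have \<epsilon>': "0 < \<epsilon>'" using assms by (simp add: \<epsilon>'_def)
  obtain X where X: "finite X" "\<And>x. F x < 1 \<Longrightarrow> \<exists>g\<in>X. x \<le> g \<and> F g \<le> F x + \<epsilon>'"
    "\<And>x. 0 < F x \<Longrightarrow> \<exists>g\<in>X. g \<le> x \<and> F x - \<epsilon>' \<le> F g"
    using F_grid[OF \<epsilon>'] by metis
  define c where "c = real (card ((UNIV :: 'm set) \<times> X))"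
  have "(\<lambda>n. c * (2 * exp (- 2 * real n * \<epsilon>'\<^sup>2))) \<longlonglongrightarrow> c * (2 * 0)"
    using \<epsilon>' by (intro tendsto_intros) real_asymp
  then have "eventually (\<lambda>n. c * (2 * exp (- 2 * real n * \<epsilon>'\<^sup>2)) < \<delta>) sequentially"
    using assms(2) by (intro order_tendstoD(2)) auto
  then obtain n0 where n0: "\<And>n. n \<ge> n0 \<Longrightarrow> c * (2 * exp (- 2 * real n * \<epsilon>'\<^sup>2)) < \<delta>"
    by (auto simp: eventually_sequentially)
  show ?thesis
  proof (intro exI[of _ n0] allI impI)
    fix n and b :: "nat \<Rightarrow> 'm"
    assume n: "n0 \<le> n" and ok: "blocks_ok n b"
    then have npos: "0 < n" by (simp add: blocks_ok_def)
    let ?M = "valuations f n"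
    interpret P: prob_space ?M by (rule prob_space_valuations)
    define B where "B kg = {v \<in> space ?M. real n * \<epsilon>' \<le>
      \<bar>real (card {i. i < n \<and> b i = fst kg \<and> v i < snd kg}) - real (card {i. i < n \<and> b i = fst kg}) * F (snd kg)\<bar>}"
      for kg :: "'m \<times> real"
    have card_sum: "real (card {i. i < n \<and> b i = k \<and> v i < x}) = (\<Sum>i<n. if b i = k \<and> v i < x then 1 else 0)" for k x and v :: "nat \<Rightarrow> real"
      by (simp add: sum.If_cases Int_def)
    have B_sets: "B kg \<in> sets ?M" for kg
      unfolding B_def card_sum by measurable
    obtain Z where Z: "{v \<in> space ?M. \<not> (\<forall>i<n. v i < 1)} \<subseteq> Z" "Z \<in> null_sets ?M"
      using AE_valuations_lt_1[of n] by (auto simp: eventually_ae_filter)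
    \<comment> \<open>Removes the large deviations at grid points and a null set containing all
      profiles with a valuation of at least 1.\<close>
    define A where "A = space ?M - ((\<Union>kg\<in>UNIV \<times> X. B kg) \<union> Z)"
    have bad_sets: "(\<Union>kg\<in>UNIV \<times> X. B kg) \<union> Z \<in> sets ?M"
      using X(1) B_sets Z by (intro sets.Un sets.finite_UN) auto
    show "\<exists>A\<in>sets ?M. 1 - \<delta> \<le> measure ?M A \<and> (\<forall>v\<in>A. typical n b \<epsilon> v)"
    proof (intro bexI[of _ A] conjI ballI)
      show "A \<in> sets ?M" unfolding A_def using bad_sets by auto
      have "measure ?M ((\<Union>kg\<in>UNIV \<times> X. B kg) \<union> Z) \<le> measure ?M (\<Union>kg\<in>UNIV \<times> X. B kg) + measure ?M Z"
        using X(1) B_sets Z(2) by (intro measure_Un_le) auto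
      also have "\<dots> = measure ?M (\<Union>kg\<in>UNIV \<times> X. B kg)"
        using Z(2) by (simp add: null_sets_def measure_def)
      also have "\<dots> \<le> (\<Sum>kg\<in>UNIV \<times> X. measure ?M (B kg))"
        using X(1) B_sets by (intro P.finite_measure_subadditive_finite) auto
      also have "\<dots> \<le> (\<Sum>kg\<in>(UNIV :: 'm set) \<times> X. 2 * exp (- 2 * real n * \<epsilon>'\<^sup>2))"
        unfolding B_def by (intro sum_mono empirical_deviation npos) (use \<epsilon>' in auto)
      also have "\<dots> \<le> \<delta>" using n0[OF n] by (simp add: c_def)
      finally show "1 - \<delta> \<le> measure ?M A"
        unfolding A_def using P.prob_compl[OF bad_sets] by linarith
    next
      fix v assume "v \<in> A"
      then have v: "v \<in> space ?M" "\<And>kg. kg \<in> UNIV \<times> X \<Longrightarrow> v \<notin> B kg" "v \<notin> Z" by (auto simp: A_def)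
      have "typical n b (2 * \<epsilon>') v"
      proof (rule typical_if_typical_on_grid[OF ok \<epsilon>' _ X(2,3)])
        show "\<forall>i<n. v i < 1" using v Z(1) by blast
      next
        fix g k assume "g \<in> X"
        then have "\<bar>real (card {i. i < n \<and> b i = k \<and> v i < g}) - real (card {i. i < n \<and> b i = k}) * F g\<bar> < real n * \<epsilon>'"
          using v(2)[of "(k, g)"] v(1) by (auto simp: B_def)
        moreover have "real (card {i. i < n \<and> b i = k \<and> v i < g}) - real (card {i. i < n \<and> b i = k}) * F g =
            real n * (real (card {i. i < n \<and> b i = k \<and> v i < g}) / real n - \<alpha> $ k * F g)"
          using ok npos by (simp add: blocks_ok_def right_diff_distrib)
        ultimately show "\<bar>real (card {i. i < n \<and> b i = k \<and> v i < g}) / real n - \<alpha> $ k * F g\<bar> \<le> \<epsilon>'"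
          using npos by (simp add: abs_mult)
      qed auto
      then show "typical n b \<epsilon> v" by (simp add: \<epsilon>'_def)
    qed
  qed
qed

end

section \<open>The limit revenue\<close>

context unit_density
begin

lemma buyers_measurable [measurable]:
  "{v \<in> space (valuations f n). buyers n b thr v H = D} \<in> sets (valuations f n)"
proof (cases "D \<subseteq> {..<n}")
  case True
  have "{v \<in> space (valuations f n). buyers n b thr v H = D} =
      {v \<in> space (valuations f n). \<forall>i\<in>{..<n}. (i \<notin> bought H \<and> thr H (b i) \<le> v i) \<longleftrightarrow> i \<in> D}"
    using True by (auto simp: buyers_def)
  also have "\<dots> \<in> sets (valuations f n)"
    by measurable
  finally show ?thesis .
next
  case False
  then have "{v \<in> space (valuations f n). buyers n b thr v H = D} = {}"
    by (auto simp: buyers_def)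
  then show ?thesis by (simp only: sets.empty_sets)
qed

text \<open>A finite range for the realized history. It splits purchase events into finitely many
  pieces, on each of which the history, and with it every threshold, is fixed.\<close>

definition histories :: "nat \<Rightarrow> nat \<Rightarrow> nat set list set" where
  "histories n r = {H. set H \<subseteq> Pow {..<n} \<and> length H = r}"

lemma finite_histories: "finite (histories n r)"
  unfolding histories_def by (intro finite_lists_length_eq) auto

lemma history_in_histories: "history n b thr v r \<in> histories n r"
  by (induction r) (auto simp: histories_def buyers_def)

lemma history_measurable [measurable]:
  "{v \<in> space (valuations f n). history n b thr v r = H} \<in> sets (valuations f n)"
proof (induction r arbitrary: H)
  case 0
  then show ?case by simp
next
  case (Suc r)
  show ?case
  proof (cases H)
    case (Cons D H')
    have "{v \<in> space (valuations f n). history n b thr v (Suc r) = H} =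
        {v \<in> space (valuations f n). history n b thr v r = H'} \<inter> {v \<in> space (valuations f n). buyers n b thr v H' = D}"
      by (auto simp: Cons)
    then show ?thesis using Suc.IH[of H'] buyers_measurable by simp
  qed auto
qed

lemma buys_measurable [measurable]:
  "{v \<in> space (valuations f n). i \<in> buyers n b thr v (history n b thr v r)} \<in> sets (valuations f n)"
proof -
  have "{v \<in> space (valuations f n). i \<in> buyers n b thr v (history n b thr v r)} =
      (\<Union>H\<in>histories n r. \<Union>D\<in>{D\<in>Pow {..<n}. i \<in> D}. {v \<in> space (valuations f n). history n b thr v r = H}
        \<inter> {v \<in> space (valuations f n). buyers n b thr v H = D})"
    using history_in_histories[of n b thr _ r] by (auto simp: buyers_def)
  also have "\<dots> \<in> sets (valuations f n)"
    by (intro sets.finite_UN finite_histories sets.Int history_measurable buyers_measurable) auto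
  finally show ?thesis .
qed

lemma sum_prob_buys:
  "(\<Sum>i<n. \<P>(v in valuations f n. i \<in> buyers n b thr v (history n b thr v r))) =
    (\<integral>v. real (card (buyers n b thr v (history n b thr v r))) \<partial>valuations f n)"
  and integrable_card_buyers:
  "integrable (valuations f n) (\<lambda>v. real (card (buyers n b thr v (history n b thr v r))))"
proof -
  interpret P: prob_space "valuations f n" by (rule prob_space_valuations)
  let ?S = "\<lambda>i. {v \<in> space (valuations f n). i \<in> buyers n b thr v (history n b thr v r)}"
  have card: "real (card (buyers n b thr v (history n b thr v r))) = (\<Sum>i<n. indicator (?S i) v)"
    if "v \<in> space (valuations f n)" for v
  proof -
    have "buyers n b thr v (history n b thr v r) = {..<n} \<inter> {i. i \<in> buyers n b thr v (history n b thr v r)}"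
      by (auto simp: buyers_def)
    then show ?thesis
      using that by (simp add: indicator_def sum.If_cases)
  qed
  have int: "integrable (valuations f n) (\<lambda>v. \<Sum>i<n. indicator (?S i) v :: real)"
    by (intro Bochner_Integration.integrable_sum integrable_real_indicator) (auto simp: P.emeasure_eq_measure)
  then show "integrable (valuations f n) (\<lambda>v. real (card (buyers n b thr v (history n b thr v r))))"
    by (subst Bochner_Integration.integrable_cong[OF refl card])
  have "(\<integral>v. real (card (buyers n b thr v (history n b thr v r))) \<partial>valuations f n) =
      (\<integral>v. (\<Sum>i<n. indicator (?S i) v) \<partial>valuations f n)"
    by (rule Bochner_Integration.integral_cong[OF refl card])
  also have "\<dots> = (\<Sum>i<n. measure (valuations f n) (?S i))"
    by (subst Bochner_Integration.integral_sum)
      (auto intro!: sum.cong simp: P.emeasure_eq_measure Int_absorb2)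
  finally show "(\<Sum>i<n. \<P>(v in valuations f n. i \<in> buyers n b thr v (history n b thr v r))) =
    (\<integral>v. real (card (buyers n b thr v (history n b thr v r))) \<partial>valuations f n)" by simp
qed

end

text \<open>The error is at most \<open>\<delta>\<close> on \<open>A\<close>, and at most 2 on the
  complement, which has probability at most \<open>\<delta>\<close>.\<close>

lemma (in prob_space) expectation_near:
  fixes X :: "'a \<Rightarrow> real"
  assumes "A \<in> events" "1 - \<delta> \<le> prob A" "integrable M X"
    and "\<And>x. x \<in> A \<Longrightarrow> \<bar>X x - \<mu>\<bar> \<le> \<delta>" "\<And>x. x \<in> space M \<Longrightarrow> \<bar>X x - \<mu>\<bar> \<le> 2" "0 \<le> \<delta>"
  shows "\<bar>expectation X - \<mu>\<bar> \<le> 3 * \<delta>"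
proof -
  have "expectation X - \<mu> = expectation (\<lambda>x. X x - \<mu>)"
    using assms by (simp add: prob_space)
  also have "\<bar>\<dots>\<bar> \<le> expectation (\<lambda>x. \<bar>X x - \<mu>\<bar>)"
    by (rule integral_abs_bound)
  also have "\<dots> \<le> expectation (\<lambda>x. \<delta> + 2 * indicator (space M - A) x)"
  proof (rule integral_mono)
    show "\<bar>X x - \<mu>\<bar> \<le> \<delta> + 2 * indicator (space M - A) x" if "x \<in> space M" for x
      using assms(4)[of x] assms(5)[OF that] \<open>0 \<le> \<delta>\<close> that by (auto simp: indicator_def)
  qed (use assms in \<open>auto simp: emeasure_eq_measure\<close>)
  also have "\<dots> = \<delta> + 2 * prob (space M - A)"
    using assms(1) by (subst Bochner_Integration.integral_add)
      (auto simp: emeasure_eq_measure prob_space Int_absorb2)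
  also have "\<dots> \<le> 3 * \<delta>"
    using assms(1,2) by (simp add: prob_compl)
  finally show ?thesis .
qed

context balanced_network
begin

lemma mass_bounds: "nondecreasing_prices T p \<Longrightarrow> t \<le> T \<Longrightarrow> 0 \<le> mass p T t \<and> mass p T t \<le> 1"
  using nondecreasing_pricesD[of T p t T] F_ge_0[of "p T"] F_le_1[of "p T"] s_pos
  by (auto simp: mass_def min_def mult_less_0_iff not_le not_less intro: order_trans)

text \<open>Uniformity over markets, equilibria and valuations by contradiction: counterexamples for
  the deviations \<open>1 / (l + 1)\<close> form a family to which
  \<open>card_buyers_tendsto\<close> applies.\<close>

lemma card_buyers_near:
  assumes p: "nondecreasing_prices T p" and t: "1 \<le> t" "t \<le> T" and "0 < \<delta>"
  shows "\<exists>\<epsilon>>0. \<forall>n b thr v. blocks_ok n b \<longrightarrow> equilibrium f E n b T p thr \<longrightarrow> typical n b \<epsilon> v \<longrightarrow>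
    \<bar>real (card (buyers n b thr v (history n b thr v (T - t)))) / real n - (mass p T (t - 1) - mass p T t)\<bar> \<le> \<delta>"
proof (rule ccontr)
  assume neg: "\<not> ?thesis"
  have "\<exists>n b thr v. blocks_ok n b \<and> equilibrium f E n b T p thr \<and> typical n b (inverse (real (Suc l))) v \<and>
    \<not> \<bar>real (card (buyers n b thr v (history n b thr v (T - t)))) / real n - (mass p T (t - 1) - mass p T t)\<bar> \<le> \<delta>" for l
  proof -
    have "0 < inverse (real (Suc l))" by simp
    with neg show ?thesis by metis
  qed
  then obtain n b thr v where *: "\<And>l. blocks_ok (n l) (b l)" "\<And>l. equilibrium f E (n l) (b l) T p (thr l)"
    "\<And>l. typical (n l) (b l) (inverse (real (Suc l))) (v l)"
    "\<And>l. \<not> \<bar>real (card (buyers (n l) (b l) (thr l) (v l) (history (n l) (b l) (thr l) (v l) (T - t)))) / real (n l)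
      - (mass p T (t - 1) - mass p T t)\<bar> \<le> \<delta>"
    by metis
  from tendstoD[OF card_buyers_tendsto[OF *(1-3) LIMSEQ_inverse_real_of_nat p t] \<open>0 < \<delta>\<close>]
  have "eventually (\<lambda>l. False) sequentially"
    by (rule eventually_mono) (use *(4) in \<open>auto simp: dist_real_def intro: less_imp_le\<close>)
  then show False by simp
qed

lemma expected_sales_near:
  assumes p: "nondecreasing_prices T p" and t: "1 \<le> t" "t \<le> T" and "0 < \<delta>"
  shows "\<exists>n0. \<forall>n\<ge>n0. \<forall>b thr. blocks_ok n b \<longrightarrow> equilibrium f E n b T p thr \<longrightarrow>
    \<bar>(\<Sum>i<n. \<P>(v in valuations f n. i \<in> buyers n b thr v (history n b thr v (T - t)))) / real n
      - (mass p T (t - 1) - mass p T t)\<bar> \<le> 3 * \<delta>"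
proof -
  obtain \<epsilon> where \<epsilon>: "0 < \<epsilon>" "\<And>n b thr v. blocks_ok n b \<Longrightarrow> equilibrium f E n b T p thr \<Longrightarrow> typical n b \<epsilon> v \<Longrightarrow>
    \<bar>real (card (buyers n b thr v (history n b thr v (T - t)))) / real n - (mass p T (t - 1) - mass p T t)\<bar> \<le> \<delta>"
    using card_buyers_near[OF assms] by metis
  obtain n0 where n0: "\<And>n b. n \<ge> n0 \<Longrightarrow> blocks_ok n b \<Longrightarrow>
    \<exists>A\<in>sets (valuations f n). 1 - \<delta> \<le> measure (valuations f n) A \<and> (\<forall>v\<in>A. typical n b \<epsilon> v)"
    using eventually_typical[OF \<epsilon>(1) \<open>0 < \<delta>\<close>] by metis
  show ?thesis
  proof (intro exI[of _ n0] allI impI)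
    fix n b thr
    assume n: "n0 \<le> n" and ok: "blocks_ok n b" and eq: "equilibrium f E n b T p thr"
    interpret P: prob_space "valuations f n" by (rule prob_space_valuations)
    obtain A where A: "A \<in> P.events" "1 - \<delta> \<le> P.prob A" "\<And>v. v \<in> A \<Longrightarrow> typical n b \<epsilon> v"
      using n0[OF n ok] by blast
    let ?X = "\<lambda>v. real (card (buyers n b thr v (history n b thr v (T - t)))) / real n"
    have X01: "0 \<le> ?X v \<and> ?X v \<le> 1" for v
    proof -
      have "card (buyers n b thr v (history n b thr v (T - t))) \<le> card {..<n}"
        by (intro card_mono) (auto simp: buyers_def)
      then show ?thesis by (auto simp: divide_le_eq_1)
    qed
    have "\<bar>P.expectation ?X - (mass p T (t - 1) - mass p T t)\<bar> \<le> 3 * \<delta>"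
    proof (rule P.expectation_near[OF A(1,2)])
      show "\<bar>?X v - (mass p T (t - 1) - mass p T t)\<bar> \<le> \<delta>" if "v \<in> A" for v
        using \<epsilon>(2)[OF ok eq A(3)[OF that]] .
      \<comment> \<open>The share of buyers and both masses lie in the unit interval.\<close>
      show "\<bar>?X v - (mass p T (t - 1) - mass p T t)\<bar> \<le> 2" for v
      proof -
        have "t - 1 \<le> T" using t by simp
        then show ?thesis
          using X01[of v] mass_bounds[OF p t(2)] mass_bounds[OF p, of "t - 1"] by linarith
      qed
      show "integrable (valuations f n) ?X"
        by (intro Bochner_Integration.integrable_divide integrable_card_buyers)
    qed (use \<open>0 < \<delta>\<close> in auto)
    then show "\<bar>(\<Sum>i<n. \<P>(v in valuations f n. i \<in> buyers n b thr v (history n b thr v (T - t)))) / real n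
      - (mass p T (t - 1) - mass p T t)\<bar> \<le> 3 * \<delta>"
      by (simp add: sum_prob_buys)
  qed
qed

definition limit_value :: "(nat \<Rightarrow> real) \<Rightarrow> nat \<Rightarrow> real" where
  "limit_value p T = (\<Sum>t=1..T. p t * (mass p T (t - 1) - mass p T t))"

text \<open>The estimate of the expected sales is uniform over block assignments and equilibria, so
  every selection of equilibria along the sequence has the same limit.\<close>

lemma limit_revenue:
  assumes p: "nondecreasing_prices T p"
    and N: "filterlim N at_top sequentially"
    and blocks: "\<And>j k. real (card {i. i < N j \<and> b j i = k}) = \<alpha> $ k * real (N j)"
  shows "limit_revenue f E N b T p (limit_value p T)"
  unfolding limit_revenue_def
proof (intro conjI allI impI)
  fix j
  show "\<exists>thr. equilibrium f E (N j) (b j) T p thr" by (rule equilibrium_exists)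
next
  fix thr
  assume eq: "\<forall>j. equilibrium f E (N j) (b j) T p (thr j)"
  let ?S = "\<lambda>t j. (\<Sum>i<N j. \<P>(v in valuations f (N j). i \<in> buyers (N j) (b j) (thr j) v (history (N j) (b j) (thr j) v (T - t))))"
  have "(\<lambda>j. ?S t j / real (N j)) \<longlonglongrightarrow> mass p T (t - 1) - mass p T t" if "1 \<le> t" "t \<le> T" for t
  proof (rule tendstoI)
    fix \<epsilon> :: real
    assume "0 < \<epsilon>"
    then have "0 < \<epsilon> / 4" by simp
    from expected_sales_near[OF p that this] obtain n0 where
      n0: "\<forall>n\<ge>n0. \<forall>b thr. blocks_ok n b \<longrightarrow> equilibrium f E n b T p thr \<longrightarrow>
        \<bar>(\<Sum>i<n. \<P>(v in valuations f n. i \<in> buyers n b thr v (history n b thr v (T - t)))) / real n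
        - (mass p T (t - 1) - mass p T t)\<bar> \<le> 3 * (\<epsilon> / 4)" ..
    \<comment> \<open>The 1 provides the non-empty market that \<open>blocks_ok\<close> asks
      for.\<close>
    have "eventually (\<lambda>j. max n0 1 \<le> N j) sequentially"
      using N unfolding filterlim_at_top by blast
    then show "eventually (\<lambda>j. dist (?S t j / real (N j)) (mass p T (t - 1) - mass p T t) < \<epsilon>) sequentially"
    proof eventually_elim
      case (elim j)
      then have "blocks_ok (N j) (b j)" by (simp add: blocks_ok_def blocks)
      with n0 elim eq have "\<bar>?S t j / real (N j) - (mass p T (t - 1) - mass p T t)\<bar> \<le> 3 * (\<epsilon> / 4)"
        by auto
      then show ?case using \<open>0 < \<epsilon>\<close> by (simp add: dist_real_def)
    qed
  qed
  then have "(\<lambda>j. \<Sum>t=1..T. p t * (?S t j / real (N j))) \<longlonglongrightarrow> (\<Sum>t=1..T. p t * (mass p T (t - 1) - mass p T t))"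
    by (intro tendsto_sum tendsto_mult_left) auto
  then show "(\<lambda>j. revenue f (N j) (b j) T p (thr j) / real (N j)) \<longlonglongrightarrow> limit_value p T"
    by (simp add: revenue_def limit_value_def sum_distrib_left sum_divide_distrib)
qed

end

section \<open>Optimal prices\<close>

text \<open>
  The density is only measurable, so \<open>F\<close> need not be differentiable. This replaces the derivative
  test: repeated bisection with respect to \<open>M\<close> halves the possible loss each time.
\<close>
lemma le_if_square_increments:
  fixes h M :: "real \<Rightarrow> real"
  assumes "x \<le> y" and M: "continuous_on {x..y} M" "mono_on {x..y} M"
    and h: "\<And>u w. x \<le> u \<Longrightarrow> u \<le> w \<Longrightarrow> w \<le> y \<Longrightarrow> h u - h w \<le> (M w - M u)\<^sup>2"
  shows "h x \<le> h y"
proof -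
  have bound: "h u - h w \<le> (M w - M u)\<^sup>2 / 2 ^ n" if "x \<le> u" "u \<le> w" "w \<le> y" for u w and n :: nat
    using that
  proof (induction n arbitrary: u w)
    case 0
    then show ?case using h by simp
  next
    case (Suc n)
    have "M u \<le> M w" using M(2) Suc.prems by (auto simp: mono_on_def)
    moreover have "continuous_on {u..w} M"
      by (rule continuous_on_subset[OF M(1)]) (use Suc.prems in auto)
    ultimately obtain z where z: "u \<le> z" "z \<le> w" "M z = (M u + M w) / 2"
      using IVT'[of M u "(M u + M w) / 2" w] Suc.prems by auto
    have "h u - h w = (h u - h z) + (h z - h w)" by simp
    also have "\<dots> \<le> (M z - M u)\<^sup>2 / 2 ^ n + (M w - M z)\<^sup>2 / 2 ^ n"
      using Suc.prems z by (intro add_mono Suc.IH) auto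
    also have "\<dots> = (M w - M u)\<^sup>2 / 2 ^ Suc n"
      by (simp add: z(3) field_simps power2_eq_square)
    finally show ?case .
  qed
  have "(\<lambda>n. (M y - M x)\<^sup>2 / 2 ^ n) \<longlonglongrightarrow> 0"
    by real_asymp
  then have "h x - h y \<le> 0"
    by (rule LIMSEQ_le_const) (use bound[of x y] assms(1) in auto)
  then show ?thesis by simp
qed

text \<open>For the decrements \<open>x\<close> of \<open>m\<close>, twice the sum of
  \<open>m t * x t\<close> plus the sum of their squares telescopes to \<open>(m 0)^2\<close>.
  Centring the squares at the mean \<open>m 0 / T\<close> makes the equal decrements visible as the
  unique maximizer.\<close>

lemma sum_mult_decrements:
  fixes m :: "nat \<Rightarrow> real"
  assumes "1 \<le> T" "m T = 0"
  shows "(\<Sum>t=1..T. m t * (m (t - 1) - m t)) = (real T - 1) / (2 * real T) * (m 0)\<^sup>2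
    - (\<Sum>t=1..T. (m (t - 1) - m t - m 0 / real T)\<^sup>2) / 2"
proof -
  have tel: "(\<Sum>t=1..k. m (t - 1) - m t) = m 0 - m k" for k
    by (induction k) auto
  have tel2: "2 * (\<Sum>t=1..k. m t * (m (t - 1) - m t)) + (\<Sum>t=1..k. (m (t - 1) - m t)\<^sup>2) = (m 0)\<^sup>2 - (m k)\<^sup>2" for k
    by (induction k) (auto simp: power2_eq_square algebra_simps)
  have "(\<Sum>t=1..T. (x t - c)\<^sup>2) = (\<Sum>t=1..T. (x t)\<^sup>2) - 2 * c * (\<Sum>t=1..T. x t) + real T * c\<^sup>2"
    for x :: "nat \<Rightarrow> real" and c
    by (simp add: power2_diff sum.distrib sum_subtractf sum_distrib_left mult_ac)
  from this[of "\<lambda>t. m (t - 1) - m t" "m 0 / real T"]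
  have "(\<Sum>t=1..T. (m (t - 1) - m t - m 0 / real T)\<^sup>2) =
      (\<Sum>t=1..T. (m (t - 1) - m t)\<^sup>2) - 2 * (m 0 / real T) * (m 0 - m T) + real T * (m 0 / real T)\<^sup>2"
    by (simp only: tel)
  also have "\<dots> = (\<Sum>t=1..T. (m (t - 1) - m t)\<^sup>2) - (m 0)\<^sup>2 / real T"
    using assms by (simp add: power2_eq_square field_simps)
  finally have "(\<Sum>t=1..T. (m (t - 1) - m t - m 0 / real T)\<^sup>2) = (\<Sum>t=1..T. (m (t - 1) - m t)\<^sup>2) - (m 0)\<^sup>2 / real T" .
  moreover have "(real T - 1) / (2 * real T) * (m 0)\<^sup>2 = (m 0)\<^sup>2 / 2 - (m 0)\<^sup>2 / real T / 2"
    using assms(1) by (simp add: field_simps)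
  moreover have "2 * (\<Sum>t=1..T. m t * (m (t - 1) - m t)) + (\<Sum>t=1..T. (m (t - 1) - m t)\<^sup>2) = (m 0)\<^sup>2"
    using tel2[of T] assms(2) by simp
  then have "(\<Sum>t=1..T. m t * (m (t - 1) - m t)) =
      (m 0)\<^sup>2 / 2 - x / 2 - ((\<Sum>t=1..T. (m (t - 1) - m t)\<^sup>2) - x) / 2" for x
    by (simp add: field_simps)
  ultimately show ?thesis by (simp only:)
qed

section \<open>The one-dimensional objective in the first price\<close>

context unit_density
begin

text \<open>Integrates a pointwise bound on the density. The factor \<open>a\<close> stays beside
  the density because it is also used with a negated bracket, where dividing could reverse the
  inequality.\<close>

lemma F_increment_le:
  assumes "u \<le> w" and le: "\<And>z. u < z \<Longrightarrow> z < w \<Longrightarrow> f z * a \<le> c"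
  shows "(F w - F u) * a \<le> (w - u) * c"
proof -
  have int: "integrable lborel (\<lambda>z. indicator {u..w} z * f z)"
    using integrable_mult_indicator[OF _ integrable_f, of "{u..w}"] by simp
  have int': "integrable lborel (\<lambda>z. indicator {u..w} z :: real)"
    using assms(1) by (intro integrable_real_indicator) auto
  have "(\<integral>z. indicator {u..w} z * f z * a \<partial>lborel) \<le> (\<integral>z. indicator {u..w} z * c \<partial>lborel)"
  proof (rule integral_mono_AE)
    show "AE z in lborel. indicator {u..w} z * f z * a \<le> indicator {u..w} z * c"
      using AE_lborel_singleton[of u] AE_lborel_singleton[of w]
    proof eventually_elim
      case (elim z)
      then show ?case using le[of z] by (auto split: split_indicator)
    qed
  qed (use int int' in auto)
  then show ?thesis
    using integral_f_Icc[OF assms(1)] assms(1) by simp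
qed

lemma demand_mono: "x \<le> y \<Longrightarrow> 1 - F y \<le> 1 - F x"
  using F_mono by simp

text \<open>The left side is the second-order remainder of an increment of the objective. The
  squared increment of the monotone potential \<open>x + (1 + d) * F x\<close> dominates it, as
  \<open>le_if_square_increments\<close> requires.\<close>

lemma square_increment_bound:
  assumes "u \<le> w" "0 \<le> d"
  shows "(w - u) * (F w - F u) + d / 2 * (F w - F u)\<^sup>2 \<le> ((w + (1 + d) * F w) - (u + (1 + d) * F u))\<^sup>2"
proof -
  define D where "D = F w - F u"
  have D: "0 \<le> D" using F_mono[OF assms(1)] by (simp add: D_def)
  have "((w + (1 + d) * F w) - (u + (1 + d) * F u))\<^sup>2 = ((w - u) + (1 + d) * D)\<^sup>2"
    by (simp add: D_def algebra_simps)
  also have "\<dots> = (w - u) * D + d / 2 * D\<^sup>2 +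
      ((w - u)\<^sup>2 + (w - u) * D + 2 * d * ((w - u) * D) + D\<^sup>2 + 3 / 2 * d * D\<^sup>2 + d\<^sup>2 * D\<^sup>2)"
    by (simp add: power2_eq_square algebra_simps)
  also have "\<dots> \<ge> (w - u) * D + d / 2 * D\<^sup>2"
    using D assms by simp
  finally show ?thesis by (simp add: D_def)
qed

lemma continuous_on_potential: "continuous_on A (\<lambda>x. x + (1 + d) * F x)"
  by (intro continuous_intros continuous_on_F)

lemma mono_on_potential: "0 \<le> d \<Longrightarrow> mono_on A (\<lambda>x. x + (1 + d) * F x)"
  by (intro mono_onI add_mono mult_left_mono F_mono) auto

text \<open>
  The shift by \<open>\<eta>\<close> turns a strict inequality for the density into a strict increase of the
  unshifted function.
\<close>
lemma objective_increasing:
  assumes "x \<le> y" "0 \<le> d"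
    and f_le: "\<And>z. x < z \<Longrightarrow> z < y \<Longrightarrow> f z * (z + \<eta> + d * (1 - F z)) \<le> 1 - F z"
  shows "(x + \<eta>) * (1 - F x) + d / 2 * (1 - F x)\<^sup>2 \<le> (y + \<eta>) * (1 - F y) + d / 2 * (1 - F y)\<^sup>2"
proof (rule le_if_square_increments[where h = "\<lambda>x. (x + \<eta>) * (1 - F x) + d / 2 * (1 - F x)\<^sup>2",
      OF assms(1) continuous_on_potential mono_on_potential[OF assms(2)]])
  fix u w assume uw: "x \<le> u" "u \<le> w" "w \<le> y"
  \<comment> \<open>Mixed endpoints on purpose: on the interval, the bracket is at least
    \<open>u + \<eta> + d * (1 - F w)\<close> and the demand at most \<open>1 - F u\<close>. The
    cost is the second-order remainder.\<close>
  have "(F w - F u) * (u + \<eta> + d * (1 - F w)) \<le> (w - u) * (1 - F u)"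
  proof (rule F_increment_le[OF uw(2)])
    fix z assume z: "u < z" "z < w"
    have "f z * (u + \<eta> + d * (1 - F w)) \<le> f z * (z + \<eta> + d * (1 - F z))"
      using z assms(2) by (intro mult_left_mono nonneg add_mono demand_mono) auto
    also have "\<dots> \<le> 1 - F z" using f_le z uw by simp
    also have "\<dots> \<le> 1 - F u" using z by (intro demand_mono) simp
    finally show "f z * (u + \<eta> + d * (1 - F w)) \<le> 1 - F u" .
  qed
  moreover have "((u + \<eta>) * (1 - F u) + d / 2 * (1 - F u)\<^sup>2) - ((w + \<eta>) * (1 - F w) + d / 2 * (1 - F w)\<^sup>2) =
      (F w - F u) * (u + \<eta> + d * (1 - F w)) - (w - u) * (1 - F u) + (w - u) * (F w - F u) + d / 2 * (F w - F u)\<^sup>2"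
    by (simp add: power2_eq_square field_simps)
  ultimately show "((u + \<eta>) * (1 - F u) + d / 2 * (1 - F u)\<^sup>2) - ((w + \<eta>) * (1 - F w) + d / 2 * (1 - F w)\<^sup>2)
      \<le> ((w + (1 + d) * F w) - (u + (1 + d) * F u))\<^sup>2"
    using square_increment_bound[OF uw(2) assms(2)] by linarith
qed

text \<open>Bisection applied to the negated objective, with the roles of the endpoints
  \<open>u\<close> and \<open>w\<close> exchanged in the bounds.\<close>

lemma objective_decreasing:
  assumes "x \<le> y" "0 \<le> d"
    and f_ge: "\<And>z. x < z \<Longrightarrow> z < y \<Longrightarrow> 1 - F z \<le> f z * (z + \<eta> + d * (1 - F z))"
  shows "(y + \<eta>) * (1 - F y) + d / 2 * (1 - F y)\<^sup>2 \<le> (x + \<eta>) * (1 - F x) + d / 2 * (1 - F x)\<^sup>2"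
proof -
  have "- ((x + \<eta>) * (1 - F x) + d / 2 * (1 - F x)\<^sup>2) \<le> - ((y + \<eta>) * (1 - F y) + d / 2 * (1 - F y)\<^sup>2)"
  proof (rule le_if_square_increments[where h = "\<lambda>x. - ((x + \<eta>) * (1 - F x) + d / 2 * (1 - F x)\<^sup>2)",
        OF assms(1) continuous_on_potential mono_on_potential[OF assms(2)]])
    fix u w assume uw: "x \<le> u" "u \<le> w" "w \<le> y"
    have "(F w - F u) * (- (w + \<eta> + d * (1 - F u))) \<le> (w - u) * (- (1 - F w))"
    proof (rule F_increment_le[OF uw(2)])
      fix z assume z: "u < z" "z < w"
      have "1 - F w \<le> 1 - F z" using z by (intro demand_mono) simp
      also have "\<dots> \<le> f z * (z + \<eta> + d * (1 - F z))" using f_ge z uw by simp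
      also have "\<dots> \<le> f z * (w + \<eta> + d * (1 - F u))"
        using z assms(2) by (intro mult_left_mono nonneg add_mono demand_mono) auto
      finally show "f z * (- (w + \<eta> + d * (1 - F u))) \<le> - (1 - F w)"
        by (simp only: mult_minus_right neg_le_iff_le)
    qed
    moreover have "- ((u + \<eta>) * (1 - F u) + d / 2 * (1 - F u)\<^sup>2) - - ((w + \<eta>) * (1 - F w) + d / 2 * (1 - F w)\<^sup>2) =
        (F w - F u) * (- (w + \<eta> + d * (1 - F u))) - (w - u) * (- (1 - F w)) + (w - u) * (F w - F u) + d / 2 * (F w - F u)\<^sup>2"
      by (simp add: power2_eq_square field_simps)
    ultimately show "- ((u + \<eta>) * (1 - F u) + d / 2 * (1 - F u)\<^sup>2) - - ((w + \<eta>) * (1 - F w) + d / 2 * (1 - F w)\<^sup>2)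
        \<le> ((w + (1 + d) * F w) - (u + (1 + d) * F u))\<^sup>2"
      using square_increment_bound[OF uw(2) assms(2)] by linarith
  qed
  then show ?thesis by simp
qed

text \<open>The formal derivative of \<open>G\<close> is \<open>- f * \<psi>\<close>, so
  \<open>G\<close> increases up to the zero \<open>a\<close> of \<open>\<psi>\<close> and decreases
  afterwards. Strictness is gained on the half of the interval away from \<open>a\<close>.\<close>

lemma objective_less_max:
  fixes d :: real
  defines "\<psi> \<equiv> \<lambda>x. x - (1 - F x) / f x + d * (1 - F x)"
    and "G \<equiv> \<lambda>x. x * (1 - F x) + d / 2 * (1 - F x)\<^sup>2"
  assumes "0 \<le> d" and a: "a \<in> {0..<1}" "0 < f a" "\<psi> a = 0"
    and \<psi>: "\<And>x y. x \<in> {0..1} \<Longrightarrow> y \<in> {0..1} \<Longrightarrow> 0 < f x \<Longrightarrow> 0 < f y \<Longrightarrow> x < y \<Longrightarrow> \<psi> x < \<psi> y"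
    and "x \<noteq> a"
  shows "G x < G a"
proof -
  have below: "f z * (z + \<eta> + d * (1 - F z)) \<le> 1 - F z" if "z \<in> {0<..<1}" "\<psi> z \<le> - \<eta>" for z \<eta>
  proof -
    have "z + \<eta> + d * (1 - F z) \<le> (1 - F z) / f z" using that(2) by (simp add: \<psi>_def)
    then show ?thesis using pos[OF that(1)] by (simp add: field_simps)
  qed
  have above: "1 - F z \<le> f z * (z + \<eta> + d * (1 - F z))" if "z \<in> {0<..<1}" "- \<eta> \<le> \<psi> z" for z \<eta>
  proof -
    have "(1 - F z) / f z \<le> z + \<eta> + d * (1 - F z)" using that(2) by (simp add: \<psi>_def)
    then show ?thesis using pos[OF that(1)] by (simp add: field_simps)
  qed
  have left: "G x < G a" if x: "0 \<le> x" "x < a" for x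
  proof -
    \<comment> \<open>Between \<open>x\<close> and the midpoint \<open>y\<close>,
      \<open>\<psi>\<close> stays below \<open>\<psi> y < 0\<close>. The shift by
      \<open>- \<psi> y\<close> then gives a gain of at least
      \<open>- \<psi> y * (F y - F x)\<close>; from \<open>y\<close> to \<open>a\<close> weak
      monotonicity suffices.\<close>
    define y where "y = (x + a) / 2"
    have y: "x < y" "y < a" "y \<in> {0<..<1}" using x a by (auto simp: y_def)
    have "\<psi> y < \<psi> a" using y a pos[of y] by (intro \<psi>) auto
    then have \<eta>: "\<psi> y < 0" using a by simp
    have "(x + - \<psi> y) * (1 - F x) + d / 2 * (1 - F x)\<^sup>2 \<le> (y + - \<psi> y) * (1 - F y) + d / 2 * (1 - F y)\<^sup>2"
    proof (rule objective_increasing)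
      fix z assume z: "x < z" "z < y"
      then have "z \<in> {0<..<1}" using x y by auto
      moreover have "\<psi> z < \<psi> y" using z x y pos[of z] pos[of y] by (intro \<psi>) auto
      ultimately show "f z * (z + - \<psi> y + d * (1 - F z)) \<le> 1 - F z" by (intro below) auto
    qed (use y \<open>0 \<le> d\<close> in auto)
    then have "G x - G y \<le> \<psi> y * (F y - F x)"
      by (simp add: G_def algebra_simps)
    also have "\<dots> < 0"
      using \<eta> F_strict_mono[of x y] x y by (intro mult_neg_pos) auto
    finally have "G x < G y" by simp
    also have "(y + 0) * (1 - F y) + d / 2 * (1 - F y)\<^sup>2 \<le> (a + 0) * (1 - F a) + d / 2 * (1 - F a)\<^sup>2"
    proof (rule objective_increasing)
      fix z assume z: "y < z" "z < a"
      then have "z \<in> {0<..<1}" using y a by auto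
      moreover have "\<psi> z < \<psi> a" using z y a pos[of z] by (intro \<psi>) auto
      ultimately show "f z * (z + 0 + d * (1 - F z)) \<le> 1 - F z" using a by (intro below) auto
    qed (use y \<open>0 \<le> d\<close> in auto)
    then have "G y \<le> G a" by (simp add: G_def)
    finally show ?thesis .
  qed
  have right: "G x < G a" if x: "a < x" "x \<le> 1" for x
  proof -
    define y where "y = (x + a) / 2"
    have y: "a < y" "y < x" "y \<in> {0<..<1}" using x a by (auto simp: y_def)
    have "\<psi> a < \<psi> y" using y a pos[of y] by (intro \<psi>) auto
    then have \<eta>: "0 < \<psi> y" using a by simp
    have "(x + - \<psi> y) * (1 - F x) + d / 2 * (1 - F x)\<^sup>2 \<le> (y + - \<psi> y) * (1 - F y) + d / 2 * (1 - F y)\<^sup>2"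
    proof (rule objective_decreasing)
      fix z assume z: "y < z" "z < x"
      then have "z \<in> {0<..<1}" using x y by auto
      moreover have "\<psi> y < \<psi> z" using z x y pos[of z] pos[of y] by (intro \<psi>) auto
      ultimately show "1 - F z \<le> f z * (z + - \<psi> y + d * (1 - F z))" by (intro above) auto
    qed (use y \<open>0 \<le> d\<close> in auto)
    then have "G x - G y \<le> - (\<psi> y * (F x - F y))"
      by (simp add: G_def algebra_simps)
    also have "\<dots> < 0"
      using \<eta> F_strict_mono[of y x] x y by simp
    finally have "G x < G y" by simp
    moreover have "(y + 0) * (1 - F y) + d / 2 * (1 - F y)\<^sup>2 \<le> (a + 0) * (1 - F a) + d / 2 * (1 - F a)\<^sup>2"
    proof (rule objective_decreasing)
      fix z assume z: "a < z" "z < y"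
      then have "z \<in> {0<..<1}" using y a by auto
      moreover have "\<psi> a < \<psi> z" using z y a pos[of z] by (intro \<psi>) auto
      ultimately show "1 - F z \<le> f z * (z + 0 + d * (1 - F z))" using a by (intro above) auto
    qed (use y \<open>0 \<le> d\<close> in auto)
    then have "G y \<le> G a" by (simp add: G_def)
    ultimately show ?thesis by simp
  qed
  \<comment> \<open>Outside the unit interval: below 0 the demand is 1 and raising the price to 0
    gains; above 1 nothing is sold, as at 1.\<close>
  consider "x < 0" | "0 \<le> x" "x < a" | "a < x" "x \<le> 1" | "1 < x"
    using \<open>x \<noteq> a\<close> by linarith
  then show ?thesis
  proof cases
    case 1
    then have "G x < G 0" by (simp add: G_def F_eq_0)
    moreover have "G 0 \<le> G a" using left[of 0] a by (cases "a = 0") auto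
    ultimately show ?thesis by simp
  next
    case 4
    then have "G x = G 1" by (simp add: G_def F_eq_1)
    then show ?thesis using right[of 1] a by simp
  qed (use left right in auto)
qed

end

section \<open>The limit value of a price sequence\<close>

context balanced_network
begin

text \<open>Whenever round \<open>t\<close> sells anything in the limit, \<open>p t\<close> equals
  \<open>p T + mass p T t / s\<close>. The value thus becomes a sum of products of masses and their
  decrements, which \<open>sum_mult_decrements\<close> evaluates.\<close>

lemma limit_value_eq:
  assumes p: "nondecreasing_prices T p" and T: "1 \<le> T"
  shows "limit_value p T = p T * (1 - F (p T)) + (real T - 1) / (real T * s) / 2 * (1 - F (p T))\<^sup>2
    - (\<Sum>t=1..T. (mass p T (t - 1) - mass p T t - (1 - F (p T)) / real T)\<^sup>2) / (2 * s)"
proof -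
  let ?m = "mass p T" and ?Q = "1 - F (p T)"
  have m0: "?m 0 = ?Q" by (simp add: mass_def)
  have mT: "?m T = 0" using T F_le_1 by (simp add: mass_def)
  have "p t * (?m (t - 1) - ?m t) = p T * (?m (t - 1) - ?m t) + 1 / s * (?m t * (?m (t - 1) - ?m t))"
    if t: "1 \<le> t" "t \<le> T" for t
  proof (cases "s * (p t - p T) \<le> ?Q")
    case True
    then have "?m t = s * (p t - p T)" using t by (simp add: mass_def)
    then have "p t = p T + 1 / s * ?m t" using s_pos by simp
    then show ?thesis by (simp add: algebra_simps)
  next
    \<comment> \<open>The price outruns the demand, so both masses equal \<open>?Q\<close> and
      nothing is sold at this round.\<close>
    case False
    have "?m (t - 1) = ?Q"
    proof (cases "t = 1")
      case False
      then have "p t \<le> p (t - 1)" using t by (intro nondecreasing_pricesD[OF p]) auto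
      then have "s * (p t - p T) \<le> s * (p (t - 1) - p T)" using s_pos by simp
      then show ?thesis using \<open>\<not> s * (p t - p T) \<le> ?Q\<close> False t by (simp add: mass_def)
    qed (simp add: mass_def)
    moreover have "?m t = ?Q" using False t by (simp add: mass_def)
    ultimately show ?thesis by simp
  qed
  then have "limit_value p T = (\<Sum>t=1..T. p T * (?m (t - 1) - ?m t) + 1 / s * (?m t * (?m (t - 1) - ?m t)))"
    unfolding limit_value_def by (intro sum.cong) auto
  also have "\<dots> = p T * (\<Sum>t=1..T. ?m (t - 1) - ?m t) + 1 / s * (\<Sum>t=1..T. ?m t * (?m (t - 1) - ?m t))"
    by (simp only: sum.distrib sum_distrib_left)
  also have "(\<Sum>t=1..T. ?m (t - 1) - ?m t) = ?Q"
  proof -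
    have "(\<Sum>t=1..k. ?m (t - 1) - ?m t) = ?m 0 - ?m k" for k by (induction k) auto
    then show ?thesis by (simp add: m0 mT)
  qed
  also note sum_mult_decrements[of T ?m, OF T mT, unfolded m0]
  finally have "limit_value p T = p T * ?Q + 1 / s * ((real T - 1) / (2 * real T) * ?Q\<^sup>2
    - (\<Sum>t=1..T. (?m (t - 1) - ?m t - ?Q / real T)\<^sup>2) / 2)" .
  moreover have "1 / s * (x / (2 * real T) * y - z / 2) = x / (real T * s) / 2 * y - z / (2 * s)" for x y z
    using s_pos T by (simp add: field_simps)
  ultimately show ?thesis by (simp only: add_diff_eq)
qed

end

section \<open>From condition (iii) to balanced influence\<close>

lemma matrix_inv_mult_vec:
  fixes A :: "real^'m^'m"
  assumes "invertible A"
  shows "A *v (matrix_inv A *v x) = x"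
proof -
  have "A ** matrix_inv A = mat 1"
    using assms someI_ex[of "\<lambda>A'. A ** A' = mat 1 \<and> A' ** A = mat 1"]
    by (auto simp: invertible_def matrix_inv_def)
  then show ?thesis by (simp add: matrix_vector_mul_assoc)
qed

lemma diag_mult_vec: "(diag a *v x) $ k = a $ k * x $ k"
proof -
  have "(\<Sum>j\<in>UNIV. (if k = j then a $ k else 0) * x $ j) = (\<Sum>j\<in>UNIV. if j = k then a $ k * x $ k else 0)"
    by (intro sum.cong) auto
  then show ?thesis by (simp add: matrix_vector_mult_def diag_def)
qed

lemma diag_mult_diag: "diag a ** diag b = diag (\<chi> k. a $ k * b $ k)"
proof -
  have "(\<Sum>k\<in>UNIV. (if i = k then a $ i else 0) * (if k = j then b $ k else 0)) =
      (\<Sum>k\<in>UNIV. if k = i then (if i = j then a $ i * b $ i else 0) else 0)" for i j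
    by (intro sum.cong) auto
  then show ?thesis
    by (simp add: vec_eq_iff matrix_matrix_mult_def diag_def)
qed

lemma sum_fractions:
  fixes b :: "nat \<Rightarrow> 'm::finite" and \<alpha> :: "real^'m"
  assumes "0 < n" "\<And>k. real (card {i. i < n \<and> b i = k}) = \<alpha> $ k * real n"
  shows "(\<Sum>k\<in>UNIV. \<alpha> $ k) = 1"
proof -
  have "real n = (\<Sum>k\<in>UNIV. real (card {i. i < n \<and> b i = k}))"
    using sum_blocks[of "{..<n}" "\<lambda>_. 1" b] by simp
  also have "\<dots> = (\<Sum>k\<in>UNIV. \<alpha> $ k) * real n"
    by (simp add: assms(2) sum_distrib_right)
  finally show ?thesis using assms(1) by simp
qed

text \<open>
  For \<open>y = E\<^sup>-\<^sup>1 1\<close>, summing \<open>y\<^sub>k \<le> \<alpha>\<^sub>k s\<close> over all blocks gives \<open>s \<le> s\<close>, so that condition (iii) leaves no room for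
  anything but \<open>y = s \<alpha>\<close>.
\<close>
lemma inverse_row_sums_eq:
  fixes E :: "real^'m^'m" and \<alpha> :: "real^'m"
  defines "s \<equiv> ones \<bullet> (matrix_inv E *v ones)"
  assumes E: "invertible E" and \<alpha>: "\<And>k. 0 < \<alpha> $ k" "(\<Sum>k\<in>UNIV. \<alpha> $ k) = 1"
    and nonneg: "\<And>k. 0 \<le> (matrix_inv (E ** diag \<alpha>) *v ones) $ k"
    and le: "\<And>k. (matrix_inv (E ** diag \<alpha>) *v ones) $ k \<le> s"
  shows "matrix_inv E *v ones = s *\<^sub>R \<alpha>" "0 < s"
proof -
  define y where "y = matrix_inv E *v ones"
  define w where "w = matrix_inv (E ** diag \<alpha>) *v ones"
  have Ey: "E *v y = ones" unfolding y_def by (rule matrix_inv_mult_vec[OF E])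
  have s: "s = (\<Sum>k\<in>UNIV. y $ k)" by (simp add: s_def y_def inner_vec_def)
  have "diag \<alpha> ** diag (\<chi> k. 1 / \<alpha> $ k) = mat 1" "diag (\<chi> k. 1 / \<alpha> $ k) ** diag \<alpha> = mat 1"
    unfolding diag_mult_diag using \<alpha>(1) by (simp_all add: diag_def mat_def vec_eq_iff less_imp_neq[symmetric])
  then have "invertible (diag \<alpha>)" by (auto simp: invertible_def)
  then have "(E ** diag \<alpha>) *v w = ones"
    unfolding w_def using E by (intro matrix_inv_mult_vec invertible_mult)
  then have "E *v (diag \<alpha> *v w) = E *v y"
    by (simp add: Ey matrix_vector_mul_assoc)
  then have "diag \<alpha> *v w = y"
    using E by (metis inj_eq inj_matrix_vector_mult)
  then have yw: "y $ k = \<alpha> $ k * w $ k" for k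
    using diag_mult_vec[of \<alpha> w k] by simp
  have y_nonneg: "0 \<le> y $ k" for k
    unfolding yw using nonneg[of k] \<alpha>(1)[of k] by (simp add: w_def)
  have y_le: "y $ k \<le> s * \<alpha> $ k" for k
    unfolding yw using le[of k] \<alpha>(1)[of k] by (simp add: w_def mult.commute)
  have "y \<noteq> 0"
  proof
    assume "y = 0"
    with Ey have "(ones :: real^'m) = 0" by simp
    then show False by (simp add: vec_eq_iff)
  qed
  then obtain k where "y $ k \<noteq> 0" by (auto simp: vec_eq_iff)
  then have "0 < y $ k" using y_nonneg[of k] by simp
  then show "0 < s" unfolding s using y_nonneg by (intro sum_pos2[of _ k]) auto
  have "(\<Sum>k\<in>UNIV. s * \<alpha> $ k - y $ k) = 0"
    by (simp add: sum_subtractf \<alpha>(2) flip: s sum_distrib_left)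
  then have "\<forall>k\<in>UNIV. s * \<alpha> $ k - y $ k = 0"
    by (subst (asm) sum_nonneg_eq_0_iff) (use y_le in auto)
  then show "matrix_inv E *v ones = s *\<^sub>R \<alpha>"
    by (simp add: vec_eq_iff y_def)
qed

section \<open>Maximizing the limit value\<close>

context balanced_network
begin

text \<open>The shortfall from \<open>R\<close> is \<open>G a - G (p T)\<close> plus a multiple of
  the sum of squares, both non-negative. If it is 0, the first part fixes \<open>p T\<close> and the
  second makes all mass decrements equal, from which the prices are read off.\<close>

lemma limit_value_unique_max:
  fixes a :: real and p :: "nat \<Rightarrow> real" and T :: nat
  defines "R \<equiv> a * (1 - F a) + (real T - 1) / (2 * real T) * (1 / s) * (1 - F a)^2"
  assumes T: "1 \<le> T"
    and ii: "mono_on {x \<in> {0..1}. 0 < f x} (\<lambda>x. x - (1 - F x) / f x - F x / s)"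
    and a: "a \<in> {0..1}" "0 < f a" "a = (1 - F a) * (1 / f a - (real T - 1) / real T * (1 / s))"
    and p: "nondecreasing_prices T p"
  shows "limit_value p T \<le> R"
    "limit_value p T = R \<Longrightarrow> 1 \<le> t \<Longrightarrow> t \<le> T \<Longrightarrow> p t = (real T - real t) * ((1 - F a) / (real T * s)) + a"
proof -
  define d where "d = (real T - 1) / (real T * s)"
  define \<psi> where "\<psi> x = x - (1 - F x) / f x + d * (1 - F x)" for x
  define G where "G x = x * (1 - F x) + d / 2 * (1 - F x)\<^sup>2" for x
  define Z where "Z = (\<Sum>t=1..T. (mass p T (t - 1) - mass p T t - (1 - F (p T)) / real T)\<^sup>2)"
  have d: "0 \<le> d" using T s_pos by (simp add: d_def)
  \<comment> \<open>At \<open>a = 1\<close> the demand vanishes and the equation for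
    \<open>a\<close> would give 0.\<close>
  have a1: "a < 1"
  proof (rule ccontr)
    assume "\<not> a < 1"
    then have "a = 1" using a(1) by simp
    then show False using a(3) F_eq_1[of 1] by simp
  qed
  then have Q: "0 < 1 - F a"
    using F_strict_mono[of a 1] a(1) F_eq_1[of 1] by simp
  have \<psi>_mono: "\<psi> x < \<psi> y" if "x \<in> {0..1}" "y \<in> {0..1}" "0 < f x" "0 < f y" "x < y" for x y
  proof -
    \<comment> \<open>The constant \<open>d\<close> falls short of \<open>1 / s\<close> by
      \<open>1 / (real T * s)\<close>; the leftover term \<open>F x / (real T * s)\<close> turns the
      monotonicity of condition (ii) into strict monotonicity.\<close>
    have \<psi>_eq: "\<psi> x = (x - (1 - F x) / f x - F x / s) + F x / (real T * s) + d" for x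
    proof -
      have "1 / s = d + 1 / (real T * s)"
        using T s_pos by (simp add: d_def field_simps)
      then have "F x * (1 / s) = F x * (d + 1 / (real T * s))" by simp
      then have "F x / s = d * F x + F x / (real T * s)"
        by (simp add: distrib_left mult.commute)
      then show ?thesis by (simp add: \<psi>_def algebra_simps)
    qed
    have "F x / (real T * s) < F y / (real T * s)"
      using F_strict_mono[of x y] that T s_pos by (intro divide_strict_right_mono) auto
    moreover have "x - (1 - F x) / f x - F x / s \<le> y - (1 - F y) / f y - F y / s"
      using mono_onD[OF ii, of x y] that by simp
    ultimately show ?thesis by (simp add: \<psi>_eq)
  qed
  have "(1 - F a) * (1 / f a - d) = (1 - F a) / f a - d * (1 - F a)"
    by (simp only: right_diff_distrib[of "1 - F a"] mult.commute[of d] times_divide_eq_right mult_1_right)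
  then have "\<psi> a = a - (1 - F a) * (1 / f a - d)"
    by (simp add: \<psi>_def)
  also have "d = (real T - 1) / real T * (1 / s)"
    by (simp add: d_def)
  finally have "\<psi> a = a - (1 - F a) * (1 / f a - (real T - 1) / real T * (1 / s))" .
  then have "\<psi> a = 0" using a(3) by simp
  then have G_less: "G x < G a" if "x \<noteq> a" for x
    unfolding G_def using a(1,2) a1 \<psi>_mono that by (intro objective_less_max d) (auto simp: \<psi>_def)
  have R: "R = G a" by (simp add: R_def G_def d_def mult.commute)
  have val: "limit_value p T = G (p T) - Z / (2 * s)"
    using limit_value_eq[OF p T] by (simp add: G_def d_def Z_def)
  have Z: "0 \<le> Z" unfolding Z_def by (intro sum_nonneg) auto
  then have Zs: "0 \<le> Z / (2 * s)" using s_pos by simp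
  have G_le: "G (p T) \<le> G a" using G_less[of "p T"] by (cases "p T = a") auto
  show "limit_value p T \<le> R" using val Zs G_le R by linarith
  assume eq: "limit_value p T = R" and t: "1 \<le> t" "t \<le> T"
  have pT: "p T = a"
  proof (rule ccontr)
    assume "p T \<noteq> a"
    then show False using G_less[of "p T"] val Zs R eq by linarith
  qed
  have "Z / (2 * s) = 0" using val Zs R eq pT by simp
  then have "Z = 0" using s_pos by simp
  then have step: "mass p T (t - 1) - mass p T t = (1 - F a) / real T" if "1 \<le> t" "t \<le> T" for t
    using that unfolding Z_def pT by (subst (asm) sum_nonneg_eq_0_iff) auto
  have "mass p T t = (1 - F a) - real t * ((1 - F a) / real T)" if "t \<le> T" for t
    using that
  proof (induction t)
    case 0
    then show ?case by (simp add: mass_def pT)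
  next
    case (Suc t)
    define c where "c = (1 - F a) / real T"
    have "mass p T t = (1 - F a) - real t * c" "mass p T t - mass p T (Suc t) = c"
      using Suc step[of "Suc t"] by (simp_all add: c_def)
    then show ?case
      unfolding c_def[symmetric] by (simp add: algebra_simps)
  qed
  from this[OF t(2)] have m': "mass p T t = (1 - F a) - real t * ((1 - F a) / real T)" .
  then have m: "mass p T t = (real T - real t) * ((1 - F a) / real T)"
    using T by (simp add: field_simps)
  \<comment> \<open>As \<open>t\<close> is at least 1, the mass stays below the demand, so the
    minimum in \<open>mass\<close> is its price term and determines \<open>p t\<close>.\<close>
  have "0 < real t * ((1 - F a) / real T)" using t T Q by simp
  then have "mass p T t < 1 - F a" using m' by linarith
  then have "s * (p t - a) = mass p T t"
    using t by (simp add: mass_def pT min_def split: if_splits)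
  then have "p t - a = mass p T t / s"
    using s_pos by (simp add: eq_divide_eq mult.commute)
  then have "p t - a = (real T - real t) * ((1 - F a) / real T) / s"
    by (simp only: m)
  then show "p t = (real T - real t) * ((1 - F a) / (real T * s)) + a" by simp
qed

text \<open>Equal price steps make the masses linear in \<open>t\<close>, down to the separately
  defined value at 0, so that the sum of squares vanishes.\<close>

lemma limit_value_linear_prices:
  fixes a :: real and T :: nat
  defines "p \<equiv> \<lambda>t. (real T - real t) * ((1 - F a) / (real T * s)) + a"
  assumes T: "1 \<le> T"
  shows "nondecreasing_prices T p"
    "limit_value p T = a * (1 - F a) + (real T - 1) / (2 * real T) * (1 / s) * (1 - F a)^2"
proof -
  have c: "0 \<le> (1 - F a) / (real T * s)" using F_le_1[of a] s_pos by simp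
  show nd: "nondecreasing_prices T p"
    unfolding nondecreasing_prices_def p_def by (intro allI impI add_right_mono mult_right_mono c) simp
  have pT: "p T = a" by (simp add: p_def)
  have m: "mass p T t = (real T - real t) * ((1 - F a) / real T)" for t
  proof (cases "t = 0")
    case False
    have "s * (p t - a) = (real T - real t) * ((1 - F a) / real T)"
      using s_pos T by (simp add: p_def)
    moreover have "(real T - real t) * ((1 - F a) / real T) \<le> real T * ((1 - F a) / real T)"
      using F_le_1[of a] by (intro mult_right_mono) auto
    ultimately show ?thesis using False T by (simp add: mass_def pT)
  qed (use T in \<open>simp add: mass_def pT\<close>)
  have "mass p T (t - 1) - mass p T t - (1 - F a) / real T = 0" if "t \<in> {1..T}" for t
  proof -
    define c where "c = (1 - F a) / real T"
    have "real (t - 1) = real t - 1" using that by auto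
    then show ?thesis unfolding m c_def[symmetric] by (simp add: algebra_simps)
  qed
  then have Z: "(\<Sum>t=1..T. (mass p T (t - 1) - mass p T t - (1 - F (p T)) / real T)\<^sup>2) = 0"
    by (simp add: pT)
  show "limit_value p T = a * (1 - F a) + (real T - 1) / (2 * real T) * (1 / s) * (1 - F a)^2"
    unfolding limit_value_eq[OF nd T] Z unfolding pT by (simp add: mult.commute)
qed

end

theorem theorem2:
  fixes E :: "real^'m^'m" and \<alpha> :: "real^'m"
    and f F :: "real \<Rightarrow> real" and T :: nat
    and N :: "nat \<Rightarrow> nat" and b :: "nat \<Rightarrow> nat \<Rightarrow> 'm"
    and s pT :: real
  defines "F \<equiv> cdf (valuation f)"
    and "s \<equiv> ones \<bullet> (matrix_inv E *v ones)"
  assumes rounds: "1 \<le> T"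
    and density: "f \<in> borel_measurable borel" "\<And>x. 0 \<le> f x" "\<And>x. x \<notin> {0..1} \<Longrightarrow> f x = 0"
      "prob_space (valuation f)"
    and density_pos: "\<And>x. x \<in> {0<..<1} \<Longrightarrow> 0 < f x"
    and network: "\<And>h k. 0 \<le> E $ h $ k"
    and fractions: "\<And>k. \<alpha> $ k \<in> {0<..1}"
    and sizes: "filterlim N at_top sequentially"
    and blocks: "\<And>j k. real (card {i. i < N j \<and> b j i = k}) = \<alpha> $ k * real (N j)"
    and cond_i: "invertible E"
    and cond_ii: "mono_on {x \<in> {0..1}. 0 < f x} (\<lambda>x. x - (1 - F x) / f x - F x / s)"
    and cond_iii: "\<And>k. 0 \<le> (matrix_inv (E ** diag \<alpha>) *v ones) $ k"
      "\<And>k. (matrix_inv (E ** diag \<alpha>) *v ones) $ k \<le> s"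
    and pT: "pT \<in> {0..1}" "0 < f pT"
      "pT = (1 - F pT) * (1 / f pT - (real T - 1) / real T * (1 / s))"
  shows "optimal_prices f E N b T
    (\<lambda>t. (real T - real t) * ((1 - F pT) / (real T * s)) + pT)
    (pT * (1 - F pT) + (real T - 1) / (2 * real T) * (1 / s) * (1 - F pT)^2)"
proof -
  \<comment> \<open>A single non-empty market suffices to see that the block fractions sum to
    1.\<close>
  have "eventually (\<lambda>j. 1 \<le> N j) sequentially"
    using sizes unfolding filterlim_at_top by blast
  then obtain j where "1 \<le> N j"
    using eventually_happens'[OF sequentially_bot] by blast
  then have \<alpha>_sum: "(\<Sum>k\<in>UNIV. \<alpha> $ k) = 1"
    by (intro sum_fractions[of "N j" "b j"] blocks) simp
  have \<alpha>_pos: "0 < \<alpha> $ k" for k using fractions[of k] by simp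
  have s: "matrix_inv E *v ones = s *\<^sub>R \<alpha>" "0 < s"
    unfolding s_def
    by (rule inverse_row_sums_eq[OF cond_i \<alpha>_pos \<alpha>_sum cond_iii[unfolded s_def]])+
  have "E *v (s *\<^sub>R \<alpha>) = ones"
    \<comment> \<open>Read row by row, this is the balance of influence.\<close>
    using matrix_inv_mult_vec[OF cond_i, of ones] s(1) by simp
  then have "s * (\<Sum>k\<in>UNIV. E $ h $ k * \<alpha> $ k) = 1" for h
    by (simp add: matrix_vector_mult_def vec_eq_iff sum_distrib_left mult.left_commute)
  then have balanced: "(\<Sum>k\<in>UNIV. E $ h $ k * \<alpha> $ k) = 1 / s" for h
    using s(2) by (simp add: field_simps)
  interpret balanced_network f E \<alpha> s
    by (intro balanced_network.intro unit_density.intro balanced_network_axioms.intro)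
      (fact density density_pos cond_i balanced s(2) \<alpha>_pos \<alpha>_sum)+
  let ?p = "\<lambda>t. (real T - real t) * ((1 - F pT) / (real T * s)) + pT"
  let ?R = "pT * (1 - F pT) + (real T - 1) / (2 * real T) * (1 / s) * (1 - F pT)^2"
  have p: "nondecreasing_prices T ?p" and R: "limit_value ?p T = ?R"
    unfolding F_def by (rule limit_value_linear_prices[OF rounds])+
  note max = limit_value_unique_max[OF rounds cond_ii[unfolded F_def] pT[unfolded F_def], folded F_def]
  show ?thesis
    unfolding optimal_prices_def
  proof (intro conjI allI impI)
    show "nondecreasing_prices T ?p" by (rule p)
    show "limit_revenue f E N b T ?p ?R"
      using limit_revenue[OF p sizes blocks] unfolding R .
    fix q
    assume q: "nondecreasing_prices T q"
    show "\<exists>L. limit_revenue f E N b T q L \<and> L \<le> ?R \<and> (L = ?R \<longrightarrow> (\<forall>t\<in>{1..T}. q t = ?p t))"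
    proof (intro exI[of _ "limit_value q T"] conjI impI ballI)
      show "limit_revenue f E N b T q (limit_value q T)"
        by (rule limit_revenue[OF q sizes blocks])
      show "limit_value q T \<le> ?R"
        by (rule max(1)[OF q])
      show "q t = ?p t" if "limit_value q T = ?R" "t \<in> {1..T}" for t
        using that by (intro max(2)[OF q]) simp_all
    qed
  qed
qed

end
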